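(* Let $F$ be a self-similar set in $\mathbb{R}^d$ satisfying OSC. Denote by $D$ its similarity dimension and let $O$ be an arbitrary strong feasible open set for $F$. Let $\eta=-\sum_{i=1}^N r_i^D\ln r_i$. (i) The relative ($D$-dimensional) Minkowski content of $F$ relative to $O^c$ is zero, i.e. $\mathcal{M}^D(F,O^c)=0$. As a consequence, the average Minkowski content of $F$ coincides with the average relative Minkowski content of $F$ relative to $O$, i.e. $\widetilde{\mathcal{M}}^D(F)=\widetilde{\mathcal{M}}^D(F,O)$. Furthermore, $F$ is ($D$-dimensional) Minkowski measurable if and only if $\mathcal{M}^D(F,O)$ exists and is positive and finite. In this case, $\mathcal{M}^D(F)=\mathcal{M}^D(F,O)$. (ii) Let $\Gamma:=O\setminus\mathbf{S}O$. Then the average Minkowski content (and, in case it exists, also the Minkowski content) of $F$ is given by the formula $$\widetilde{\mathcal{M}}^D(F)=\frac1\eta\int_0^\infty\varepsilon^{D-d-1}\lambda_d(F_\varepsilon\cap\Gamma)\,d\varepsilon$$ if and only if $D<d$ and the projection condition $S_iO\subset\overline{\pi_F^{-1}(S_iF)}$, $i=1,\dots,N$, holds. (iii) Let $G:=O\setminus\overline{\mathbf{S}O}$. The assertion in (ii) remains true with the set $\Gamma$ in the formula replaced by $G$, provided $\lambda_d(\partial G)=0$.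
   Context: $N\ge2$, $S_1,\dots,S_N:\mathbb{R}^d\to\mathbb{R}^d$ are contracting similarities with ratios $r_i\in(0,1)$ (an IFS), $\mathbf{S}(A):=\bigcup_{i=1}^N S_i(A)$, and the self-similar set $F$ is the unique nonempty compact set with $\mathbf{S}F=F$. The similarity dimension $D$ is the unique real solution of $\sum_{i=1}^N r_i^D=1$. A feasible open set for $F$ is a nonempty bounded open set $O$ with $S_iO\subset O$ for all $i$ and $S_iO\cap S_jO=\emptyset$ for $i\ne j$; OSC means that one exists; $O$ is strong if $O\cap F\ne\emptyset$. $\lambda_d$ is Lebesgue measure and $A_\varepsilon:=\{z:\inf_{a\in A}|a-z|\le\varepsilon\}$. For bounded $A$ and $\Omega\subset\mathbb{R}^d$, $\mathcal{M}^s(A,\Omega):=\lim_{\varepsilon\searrow0}\varepsilon^{s-d}\lambda_d(A_\varepsilon\cap\Omega)$ and $\widetilde{\mathcal{M}}^s(A,\Omega):=\lim_{\delta\searrow0}\frac1{|\ln\delta|}\int_\delta^1\varepsilon^{s-d}\lambda_d(A_\varepsilon\cap\Omega)\frac{d\varepsilon}{\varepsilon}$, whenever the limits exist; $\mathcal{M}^s(A):=\mathcal{M}^s(A,\mathbb{R}^d)$, $\widetilde{\mathcal{M}}^s(A):=\widetilde{\mathcal{M}}^s(A,\mathbb{R}^d)$. $F$ is $D$-dimensional Minkowski measurable if $\mathcal{M}^D(F)$ exists and is positive and finite. $\pi_F$ is the metric projection onto $F$, defined on the set $U(F)$ of points of $\mathbb{R}^d$ having a unique nearest point in $F$; $\pi_F^{-1}(S_iF)=\{x\in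 U(F):\pi_F(x)\in S_iF\}$. *)

theory Defs
  imports "HOL-Analysis.Analysis"
begin

definition similarity_ifs :: "nat \<Rightarrow> (nat \<Rightarrow> 'a::euclidean_space \<Rightarrow> 'a) \<Rightarrow> (nat \<Rightarrow> real) \<Rightarrow> bool" where
  "similarity_ifs N S r \<longleftrightarrow>
     2 \<le> N \<and> (\<forall>i\<in>{1..N}. 0 < r i \<and> r i < 1 \<and> (\<forall>x y. dist (S i x) (S i y) = r i * dist x y))"

definition ifs_image :: "nat \<Rightarrow> (nat \<Rightarrow> 'a \<Rightarrow> 'a) \<Rightarrow> 'a set \<Rightarrow> 'a set" where
  "ifs_image N S A = (\<Union>i\<in>{1..N}. S i ` A)"

text \<open>By Hutchinson's theorem exactly one set \<open>F\<close> satisfies this for a given IFS.\<close>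

definition self_similar_set :: "nat \<Rightarrow> (nat \<Rightarrow> 'a::euclidean_space \<Rightarrow> 'a) \<Rightarrow> 'a set \<Rightarrow> bool" where
  "self_similar_set N S F \<longleftrightarrow> F \<noteq> {} \<and> compact F \<and> ifs_image N S F = F"

definition feasible_open_set :: "nat \<Rightarrow> (nat \<Rightarrow> 'a::euclidean_space \<Rightarrow> 'a) \<Rightarrow> 'a set \<Rightarrow> bool" where
  "feasible_open_set N S V \<longleftrightarrow>
     V \<noteq> {} \<and> bounded V \<and> open V \<and>
     (\<forall>i\<in>{1..N}. S i ` V \<subseteq> V) \<and> disjoint_family_on (\<lambda>i. S i ` V) {1..N}"

definition open_set_condition :: "nat \<Rightarrow> (nat \<Rightarrow> 'a::euclidean_space \<Rightarrow> 'a) \<Rightarrow> bool" where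
  "open_set_condition N S \<longleftrightarrow> (\<exists>V. feasible_open_set N S V)"

definition strong_feasible_open_set ::
    "nat \<Rightarrow> (nat \<Rightarrow> 'a::euclidean_space \<Rightarrow> 'a) \<Rightarrow> 'a set \<Rightarrow> 'a set \<Rightarrow> bool" where
  "strong_feasible_open_set N S F V \<longleftrightarrow> feasible_open_set N S V \<and> V \<inter> F \<noteq> {}"

text \<open>Meant for nonempty \<open>A\<close>: the library sets \<^term>\<open>infdist z {} = 0\<close>.\<close>

definition parallel_set :: "'a::euclidean_space set \<Rightarrow> real \<Rightarrow> 'a set" where
  "parallel_set A \<epsilon> = {z. infdist z A \<le> \<epsilon>}"

text \<open>The (relative, average) Minkowski contents are limits in \<open>[0, \<infinity>]\<close>;
  \<open>has_minkowski_content s A W m\<close> says that the limit exists and equals \<open>m\<close>, which is then unique.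
  Integrals are taken in the nonnegative extended sense, so that no
  integrability side conditions arise. The sets \<open>W\<close> are meant to be Lebesgue measurable,
  since \<^const>\<open>emeasure\<close> is \<open>0\<close> on nonmeasurable sets.\<close>

definition has_minkowski_content ::
    "real \<Rightarrow> 'a::euclidean_space set \<Rightarrow> 'a set \<Rightarrow> ennreal \<Rightarrow> bool" where
  "has_minkowski_content s A W m \<longleftrightarrow>
     ((\<lambda>\<epsilon>. ennreal (\<epsilon> powr (s - real DIM('a))) * emeasure lebesgue (parallel_set A \<epsilon> \<inter> W))
        \<longlongrightarrow> m) (at_right 0)"

definition has_average_minkowski_content ::
    "real \<Rightarrow> 'a::euclidean_space set \<Rightarrow> 'a set \<Rightarrow> ennreal \<Rightarrow> bool" where
  "has_average_minkowski_content s A W m \<longleftrightarrow>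
     ((\<lambda>\<delta>. ennreal (1 / \<bar>ln \<delta>\<bar>) *
        (\<integral>\<^sup>+\<epsilon>\<in>{\<delta>..1}. ennreal (\<epsilon> powr (s - real DIM('a))) *
            emeasure lebesgue (parallel_set A \<epsilon> \<inter> W) * ennreal (1 / \<epsilon>) \<partial>lborel))
        \<longlongrightarrow> m) (at_right 0)"

definition minkowski_measurable :: "real \<Rightarrow> 'a::euclidean_space set \<Rightarrow> bool" where
  "minkowski_measurable s A \<longleftrightarrow> (\<exists>m. has_minkowski_content s A UNIV m \<and> 0 < m \<and> m < \<infinity>)"

definition content_integral :: "real \<Rightarrow> 'a::euclidean_space set \<Rightarrow> 'a set \<Rightarrow> ennreal" where
  "content_integral s A W =
     (\<integral>\<^sup>+\<epsilon>\<in>{0<..}. ennreal (\<epsilon> powr (s - real DIM('a) - 1)) *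
        emeasure lebesgue (parallel_set A \<epsilon> \<inter> W) \<partial>lborel)"

definition unique_nearest_points :: "'a::euclidean_space set \<Rightarrow> 'a set" where
  "unique_nearest_points A = {x. \<exists>!y. y \<in> A \<and> (\<forall>z\<in>A. dist x y \<le> dist x z)}"

text \<open>On \<^term>\<open>unique_nearest_points A\<close> the library's \<^const>\<open>closest_point\<close> is the
  metric projection onto \<open>A\<close>; elsewhere it makes an arbitrary choice, so its domain has
  to be restricted.\<close>

definition projection_preimage :: "'a::euclidean_space set \<Rightarrow> 'a set \<Rightarrow> 'a set" where
  "projection_preimage A B = {x \<in> unique_nearest_points A. closest_point A x \<in> B}"

definition projection_condition ::
    "nat \<Rightarrow> (nat \<Rightarrow> 'a::euclidean_space \<Rightarrow> 'a) \<Rightarrow> 'a set \<Rightarrow> 'a set \<Rightarrow> bool" where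
  "projection_condition N S F V \<longleftrightarrow>
     (\<forall>i\<in>{1..N}. S i ` V \<subseteq> closure (projection_preimage F (S i ` F)))"

end

theory Submission
  imports Defs
begin

text \<open>
  Write \<open>d\<close> for the dimension of the space and \<open>g(\<epsilon>)\<close> for \<open>\<epsilon>\<close> to the power \<open>D - d\<close> times the volume
  of the part of the parallel set \<open>F_\<epsilon>\<close> in a given region. The factor is chosen such that a similarity with
  ratio \<open>c\<close> turns \<open>g(\<epsilon>)\<close> into \<open>c powr D * g(\<epsilon> / c)\<close>; since the numbers \<open>r_i powr D\<close> sum to one,
  self-similarity makes \<open>g\<close> comparable to a weighted mean of its own values at larger arguments.
  Everything rests on three such comparisons.

  Covering \<open>F_\<epsilon>\<close> by the parallel sets of the pieces \<open>S_i F\<close> gives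
  \<open>g(\<epsilon>) \<le> (\<Sum>i. r_i powr D * g(\<epsilon> / r_i))\<close> in the whole space; a bound on one range of scales then
  holds on all smaller ones (\<open>scaled_UNIV_bounded\<close>).

  Outside of \<open>V\<close> one can do better. As \<open>V\<close> is strong, some small copy \<open>T F\<close> of \<open>F\<close> lies well inside of \<open>V\<close>
  and contributes nothing to the volume of \<open>F_\<epsilon>\<close> outside of \<open>V\<close> for small \<open>\<epsilon>\<close>. The weights of the remaining
  copies sum to a number smaller than one, so that \<open>g\<close> is contracted at every step and tends to zero
  (\<open>scaled_outside_tendsto_0\<close>). This is the first part, and it permits replacing the whole space by \<open>V\<close>.

  Inside of \<open>V\<close> there is an exact renewal equation, because \<open>V\<close> is the disjoint union of \<open>\<Gamma>\<close> and the sets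
  \<open>S_i V\<close>, and the part of \<open>(S_i F)_\<epsilon>\<close> in \<open>S_i V\<close> is a scaled copy of a parallel set of \<open>F\<close> in \<open>V\<close>
  (\<open>renewal_equation\<close>). Its error terms are nonnegative: the part of \<open>F_\<epsilon>\<close> in \<open>\<Gamma>\<close>, and for each \<open>i\<close> the
  excess of \<open>F_\<epsilon>\<close> over \<open>(S_i F)_\<epsilon>\<close> in \<open>S_i V\<close>. For logarithmic averages the renewal theorem is
  elementary (\<open>averaged_renewal_theorem\<close>): boundedness of \<open>g\<close> alone forces the errors to be integrable, and
  the average of \<open>g\<close> is their total integral divided by \<open>\<eta>\<close>, plus the limit of \<open>g\<close> at infinity. That
  limit is zero if \<open>D < d\<close> and the volume of \<open>V\<close> if \<open>D = d\<close>.

  Hence the integral over \<open>\<Gamma>\<close> alone gives the average content if and only if \<open>D < d\<close> and all the excess terms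
  integrate to zero. The latter means that in \<open>S_i V\<close> the distances to \<open>F\<close> and to \<open>S_i F\<close> agree. This is the
  projection condition: moving a point along the segment towards one of its nearest points makes the nearest
  point unique (\<open>closure_projection_preimage\<close>). If the Minkowski content exists, it equals the average content.

  For the last part, a point of the frontier of \<open>V\<close> lies in the frontier of \<open>G\<close> or in some \<open>S_i\<close>-image of the
  frontier of \<open>V\<close>. If \<open>D < d\<close>, the ratios to the power \<open>d\<close> sum to less than one, so that the frontier of \<open>V\<close>
  is null when the frontier of \<open>G\<close> is (\<open>frontier_V_null\<close>), and with it the difference of \<open>\<Gamma>\<close> and \<open>G\<close>. If
  \<open>D = d\<close>, then \<open>\<Gamma>\<close> itself is null.
\<close>

section \<open>Averaged renewal theorem\<close>

lemma bounded_borel_integrable_on: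
  fixes f :: "real \<Rightarrow> real"
  assumes "f \<in> borel_measurable borel" and "\<And>x. x \<in> {a..b} \<Longrightarrow> \<bar>f x\<bar> \<le> M"
  shows "f integrable_on {a..b}"
proof -
  have "f absolutely_integrable_on {a..b}"
  proof (rule measurable_bounded_by_integrable_imp_absolutely_integrable)
    show "f \<in> borel_measurable (lebesgue_on {a..b})"
      using assms(1) by (simp add: measurable_completion measurable_restrict_space1)
    show "(\<lambda>_. M) integrable_on {a..b}" by (rule integrable_const_ivl)
  qed (use assms(2) in auto)
  then show ?thesis by (rule set_lebesgue_integral_eq_integral(1))
qed

lemma integral_bounds_Icc:
  fixes f :: "real \<Rightarrow> real"
  assumes "f integrable_on {a..b}" "a \<le> b" "\<And>x. x \<in> {a..b} \<Longrightarrow> l \<le> f x \<and> f x \<le> u"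
  shows "(b - a) * l \<le> integral {a..b} f" "integral {a..b} f \<le> (b - a) * u"
proof -
  have "integral {a..b} (\<lambda>_. l) \<le> integral {a..b} f"
    by (intro integral_le assms(1) integrable_const_ivl) (use assms(3) in auto)
  then show "(b - a) * l \<le> integral {a..b} f" using assms(2) by simp
  have "integral {a..b} f \<le> integral {a..b} (\<lambda>_. u)"
    by (intro integral_le assms(1) integrable_const_ivl) (use assms(3) in auto)
  then show "integral {a..b} f \<le> (b - a) * u" using assms(2) by simp
qed

text \<open>Over long intervals, shifting a function changes its integral only by boundary terms.\<close>

lemma integral_minus_shifted_integral:
  fixes f :: "real \<Rightarrow> real"
  assumes int: "f integrable_on {a..b + \<tau>}" and "a \<le> b" "0 \<le> \<tau>"
  shows "integral {a..b} f - integral {a..b} (\<lambda>s. f (s + \<tau>))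
       = integral {a..a + \<tau>} f - integral {b..b + \<tau>} f"
proof -
  have "integral {a..b} (\<lambda>s. f (s + \<tau>)) = integral {a + \<tau>..b + \<tau>} f"
    using integral_shift_real_ivl[of "a + \<tau>" \<tau> "b + \<tau>" f] by simp
  moreover have "integral {a..b} f + integral {b..b + \<tau>} f = integral {a..b + \<tau>} f"
    by (rule Henstock_Kurzweil_Integration.integral_combine) (use assms in auto)
  moreover have "integral {a..a + \<tau>} f + integral {a + \<tau>..b + \<tau>} f = integral {a..b + \<tau>} f"
    by (rule Henstock_Kurzweil_Integration.integral_combine) (use assms in auto)
  ultimately show ?thesis by linarith
qed

text \<open>The part of the interval on which \<open>h\<close> is not yet close to \<open>L\<close> is fixed, so that its contribution is divided away.\<close>

lemma cesaro_mean_at_bot: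
  fixes h :: "real \<Rightarrow> real"
  assumes int: "\<And>a b. h integrable_on {a..b}" and lim: "(h \<longlongrightarrow> L) at_bot"
  shows "((\<lambda>T. 1 / T * integral {-T..0} h) \<longlongrightarrow> L) at_top"
proof (rule tendstoI)
  fix e :: real assume e: "e > 0"
  have "\<forall>\<^sub>F s in at_bot. dist (h s) L < e / 2" using tendstoD[OF lim, of "e/2"] e by simp
  then obtain s1 where s1: "\<And>s. s \<le> s1 \<Longrightarrow> \<bar>h s - L\<bar> < e / 2"
    unfolding eventually_at_bot_linorder dist_real_def by auto
  define s0 where "s0 = min s1 (-1)"
  have s0: "s0 < 0" "\<And>s. s \<le> s0 \<Longrightarrow> \<bar>h s - L\<bar> < e / 2" using s1 by (auto simp: s0_def)
  define C where "C = integral {s0..0} (\<lambda>s. h s - L)"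
  have int': "(\<lambda>s. h s - L) integrable_on {a..b}" for a b
    by (intro integrable_diff int integrable_const_ivl)
  have "\<forall>\<^sub>F T in at_top. T > max (- s0) (2 * \<bar>C\<bar> / e)" by (rule eventually_gt_at_top)
  then show "\<forall>\<^sub>F T in at_top. dist (1 / T * integral {-T..0} h) L < e"
  proof (rule eventually_mono)
    fix T :: real assume T: "T > max (- s0) (2 * \<bar>C\<bar> / e)"
    then have T0: "T > 0" using s0 by linarith
    have bd: "- (e/2) \<le> h s - L \<and> h s - L \<le> e/2" if "s \<in> {-T..s0}" for s
    proof -
      have "\<bar>h s - L\<bar> < e / 2" using s0(2)[of s] that by simp
      then show ?thesis by linarith
    qed
    have eq: "(s0 - (-T)) * (- (e/2)) = - (s0 * e / 2) - T * e / 2" "(s0 - (-T)) * (e/2) = s0 * e / 2 + T * e / 2"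
      by (simp_all add: field_simps)
    have b: "(s0 - (-T)) * (- (e/2)) \<le> integral {-T..s0} (\<lambda>s. h s - L)"
      "integral {-T..s0} (\<lambda>s. h s - L) \<le> (s0 - (-T)) * (e/2)"
      by (rule integral_bounds_Icc[OF int' _ bd]; use T in simp)+
    have "integral {-T..0} (\<lambda>s. h s - L) = integral {-T..0} h - T * L"
      using T0 by (subst Henstock_Kurzweil_Integration.integral_diff) (auto intro: int integrable_const_ivl)
    moreover have "integral {-T..s0} (\<lambda>s. h s - L) + C = integral {-T..0} (\<lambda>s. h s - L)"
      unfolding C_def
      by (rule Henstock_Kurzweil_Integration.integral_combine) (use T s0 int' in auto)
    moreover note b
    moreover have "2 * \<bar>C\<bar> < T * e" using T e by (simp add: field_simps)
    moreover have "s0 * e < 0" using s0(1) e by (simp add: mult_neg_pos)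
    ultimately have "integral {-T..0} h - T * L < T * e" "- (integral {-T..0} h - T * L) < T * e"
      unfolding eq by linarith+
    then have "\<bar>integral {-T..0} h - T * L\<bar> < T * e" by linarith
    then show "dist (1 / T * integral {-T..0} h) L < e"
      using T0 by (simp add: dist_real_def field_simps abs_less_iff)
  qed
qed

lemma antimono_bounded_tendsto_at_bot:
  fixes A :: "real \<Rightarrow> real"
  assumes "\<And>a b. a \<le> b \<Longrightarrow> A b \<le> A a" and "\<And>s. A s \<le> B"
  obtains L where "(A \<longlongrightarrow> L) at_bot" "\<And>s. A s \<le> L"
proof
  have bdd: "bdd_above (range A)" using assms(2) by (auto intro!: bdd_aboveI)
  show le: "A s \<le> (SUP s. A s)" for s by (rule cSUP_upper[OF _ bdd]) simp
  show "(A \<longlongrightarrow> (SUP s. A s)) at_bot"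
  proof (rule increasing_tendsto)
    fix x assume "x < (SUP s. A s)"
    then obtain s where s: "x < A s" using less_cSUP_iff[OF _ bdd] by auto
    show "\<forall>\<^sub>F n in at_bot. x < A n"
      using eventually_le_at_bot[of s] by (rule eventually_mono) (use assms(1) s less_le_trans in blast)
  qed (use le in auto)
qed

text \<open>Let \<open>A s\<close> be the sum of \<open>p i\<close> times the integral of \<open>Z\<close> over \<open>{s..s + \<tau> i}\<close>. Integrating the
  renewal equation \<open>Z s = z s + (\<Sum>i\<in>I. p i * Z (s + \<tau> i))\<close> over an interval telescopes to
  \<open>integral {a..b} z = A a - A b\<close>. Since \<open>z\<close> is nonnegative and \<open>Z\<close> bounded, \<open>A\<close> is monotone and bounded, so
  that \<open>z\<close> is integrable and \<open>A\<close> converges at both ends. The same telescoping shows that the means of \<open>A\<close> and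
  of \<open>\<eta> * Z\<close> over \<open>{-T..0}\<close> differ by \<open>O(1 / T)\<close>. The averages run towards \<open>-\<infinity>\<close> because \<open>s\<close> stands for the
  logarithm of the parallel distance \<open>\<epsilon>\<close>, which tends to zero.\<close>

lemma averaged_renewal_theorem:
  fixes Z z :: "real \<Rightarrow> real" and p \<tau> :: "'i \<Rightarrow> real"
  assumes I: "finite I" "(\<Sum>i\<in>I. p i) = 1" "\<And>i. i \<in> I \<Longrightarrow> 0 \<le> p i \<and> 0 < \<tau> i"
    and \<eta>: "\<eta> = (\<Sum>i\<in>I. p i * \<tau> i)" "\<eta> > 0"
    and Z: "Z \<in> borel_measurable borel" "\<And>s. 0 \<le> Z s" "\<And>s. Z s \<le> M"
    and Zlim: "(Z \<longlongrightarrow> Zinf) at_top"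
    and z: "\<And>s. z s = Z s - (\<Sum>i\<in>I. p i * Z (s + \<tau> i))" "\<And>s. 0 \<le> z s"
  obtains C where "0 \<le> C" "(\<integral>\<^sup>+s. ennreal (z s) \<partial>lborel) = ennreal C"
    "((\<lambda>T. 1 / T * integral {-T..0} Z) \<longlongrightarrow> C / \<eta> + Zinf) at_top"
proof -
  have Zint: "Z integrable_on {a..b}" for a b
    by (rule bounded_borel_integrable_on[OF Z(1), where M = M]) (use Z in \<open>auto simp: abs_le_iff intro: order_trans\<close>)
  have Zshint: "(\<lambda>s. Z (s + c)) integrable_on {a..b}" for a b c
    using integrable_shift_real_ivl[OF Zint[of "a+c" "b+c"], of c] by simp
  have M: "0 \<le> M" using Z(2,3)[of 0] by linarith
  define A where "A s = (\<Sum>i\<in>I. p i * integral {s..s + \<tau> i} Z)" for s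
  have Zbd: "0 \<le> integral {a..b} Z" "integral {a..b} Z \<le> (b - a) * M" if "a \<le> b" for a b
    using integral_bounds_Icc[OF Zint that, of 0 M] Z by auto
  have intz: "(z has_integral (A a - A b)) {a..b}" if "a \<le> b" for a b
  proof -
    have "(\<lambda>s. Z s - (\<Sum>i\<in>I. p i * Z (s + \<tau> i))) integrable_on {a..b}"
      by (intro integrable_diff Zint integrable_sum I integrable_on_mult_right Zshint)
    moreover have "integral {a..b} (\<lambda>s. Z s - (\<Sum>i\<in>I. p i * Z (s + \<tau> i)))
       = integral {a..b} Z - (\<Sum>i\<in>I. p i * integral {a..b} (\<lambda>s. Z (s + \<tau> i)))"
      by (subst Henstock_Kurzweil_Integration.integral_diff)
         (auto intro!: Zint integrable_sum I integrable_on_mult_right Zshint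
               simp: Henstock_Kurzweil_Integration.integral_sum[OF I(1) integrable_on_mult_right[OF Zshint]])
    moreover have "\<dots> = (\<Sum>i\<in>I. p i * (integral {a..b} Z - integral {a..b} (\<lambda>s. Z (s + \<tau> i))))"
      by (simp add: right_diff_distrib sum_subtractf sum_distrib_right[symmetric] I)
    moreover have "\<dots> = A a - A b"
      unfolding A_def sum_subtractf[symmetric] right_diff_distrib[symmetric]
      by (intro sum.cong refl arg_cong2[where f="(*)"] integral_minus_shifted_integral Zint)
         (use that I(3) less_imp_le in auto)
    moreover have "z = (\<lambda>s. Z s - (\<Sum>i\<in>I. p i * Z (s + \<tau> i)))" using z(1) by blast
    ultimately show ?thesis using integrable_integral by fastforce
  qed
  have anti: "A b \<le> A a" if "a \<le> b" for a b
    using has_integral_nonneg[OF intz[OF that]] z(2) by auto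
  have Abd: "0 \<le> A s" "A s \<le> \<eta> * M" for s
  proof -
    have le: "s \<le> s + \<tau> i" if "i \<in> I" for i using I(3)[OF that] by simp
    show "0 \<le> A s" unfolding A_def
      by (intro sum_nonneg mult_nonneg_nonneg Zbd) (use I(3) le in auto)
    have "A s \<le> (\<Sum>i\<in>I. p i * ((s + \<tau> i - s) * M))" unfolding A_def
      by (intro sum_mono mult_left_mono Zbd) (use I(3) le in auto)
    also have "\<dots> = \<eta> * M" by (simp add: \<eta>(1) sum_distrib_right mult.assoc)
    finally show "A s \<le> \<eta> * M" .
  qed
  obtain L where L: "(A \<longlongrightarrow> L) at_bot" "\<And>s. A s \<le> L"
    using antimono_bounded_tendsto_at_bot[of A, OF anti Abd(2)] by blast
  have Atop: "(A \<longlongrightarrow> \<eta> * Zinf) at_top"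
  proof -
    have "((\<lambda>s. integral {s..s + \<tau> i} Z) \<longlongrightarrow> \<tau> i * Zinf) at_top" if i: "i \<in> I" for i
    proof (rule tendstoI)
      fix e :: real assume e: "e > 0"
      have t: "\<tau> i > 0" using I(3) i by auto
      have "\<forall>\<^sub>F s in at_top. dist (Z s) Zinf < e / (2 * \<tau> i)" using tendstoD[OF Zlim, of "e/(2*\<tau> i)"] e t by simp
      then obtain s0 where s0: "\<And>s. s \<ge> s0 \<Longrightarrow> \<bar>Z s - Zinf\<bar> < e / (2 * \<tau> i)"
        unfolding eventually_at_top_linorder dist_real_def by auto
      show "\<forall>\<^sub>F s in at_top. dist (integral {s..s + \<tau> i} Z) (\<tau> i * Zinf) < e"
        using eventually_ge_at_top[of s0]
      proof (rule eventually_mono)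
        fix s assume s: "s0 \<le> s"
        have bd: "Zinf - e/(2*\<tau> i) \<le> Z x \<and> Z x \<le> Zinf + e/(2*\<tau> i)" if "x \<in> {s..s+\<tau> i}" for x
          using s0[of x] that s by (auto simp: abs_less_iff)
        have eq: "(s+\<tau> i - s) * (Zinf - e/(2*\<tau> i)) = \<tau> i * Zinf - e/2"
          "(s+\<tau> i - s) * (Zinf + e/(2*\<tau> i)) = \<tau> i * Zinf + e/2"
          using t by (simp_all add: field_simps)
        have "(s+\<tau> i - s) * (Zinf - e/(2*\<tau> i)) \<le> integral {s..s+\<tau> i} Z"
          "integral {s..s+\<tau> i} Z \<le> (s+\<tau> i - s) * (Zinf + e/(2*\<tau> i))"
          by (rule integral_bounds_Icc[OF Zint _ bd]; use t in simp)+
        then have "\<bar>integral {s..s + \<tau> i} Z - \<tau> i * Zinf\<bar> \<le> e/2" unfolding eq by linarith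
        then show "dist (integral {s..s + \<tau> i} Z) (\<tau> i * Zinf) < e"
          using e by (simp add: dist_real_def)
      qed
    qed
    then have "(A \<longlongrightarrow> (\<Sum>i\<in>I. p i * (\<tau> i * Zinf))) at_top" unfolding A_def
      by (intro tendsto_sum tendsto_mult tendsto_const) auto
    then show ?thesis by (simp add: \<eta>(1) sum_distrib_right mult.assoc)
  qed
  define C where "C = L - \<eta> * Zinf"
  have lims: "(\<lambda>n::nat. A (- real n) - A (real n)) \<longlonglongrightarrow> C" unfolding C_def
    by (intro tendsto_diff filterlim_compose[OF L(1)] filterlim_compose[OF Atop]
        filterlim_real_sequentially filterlim_compose[OF filterlim_uminus_at_bot_at_top])
  have C0: "0 \<le> C" by (rule LIMSEQ_le_const[OF lims]) (auto intro!: exI[of _ 0] anti)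
  have zmeas: "z \<in> borel_measurable borel"
  proof -
    have "(\<lambda>s. Z s - (\<Sum>i\<in>I. p i * Z (s + \<tau> i))) \<in> borel_measurable borel" using Z(1) by measurable
    then show ?thesis using z(1) by presburger
  qed
  have nnz: "(\<integral>\<^sup>+s. ennreal (z s) \<partial>lborel) = ennreal C"
  proof -
    have "(\<lambda>n::nat. \<integral>\<^sup>+s. ennreal (indicator {- real n..real n} s * z s) \<partial>lborel)
        \<longlonglongrightarrow> (\<integral>\<^sup>+s. ennreal (z s) \<partial>lborel)"
    proof (rule nn_integral_LIMSEQ)
      show "incseq (\<lambda>(n::nat) s. ennreal (indicator {- real n..real n} s * z s))"
        using z(2) by (auto simp: incseq_def le_fun_def indicator_def intro!: ennreal_leI)
      show "(\<lambda>s. ennreal (indicator {- real n..real n} s * z s)) \<in> borel_measurable lborel" for n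
        using zmeas by measurable
      show "(\<lambda>n. ennreal (indicator {- real n..real n} s * z s)) \<longlonglongrightarrow> ennreal (z s)" for s
      proof (rule tendsto_eventually)
        obtain n0 :: nat where "\<bar>s\<bar> \<le> real n0" using real_arch_simple by blast
        then have n0: "- real n \<le> s \<and> s \<le> real n" if "n \<ge> n0" for n
          using that of_nat_mono[OF that, where 'a=real] by linarith
        show "\<forall>\<^sub>F n in sequentially. ennreal (indicator {- real n..real n} s * z s) = ennreal (z s)"
          unfolding eventually_sequentially by (intro exI[of _ n0]) (auto simp: indicator_def dest: n0)
      qed
    qed
    moreover have "(\<integral>\<^sup>+s. ennreal (indicator {- real n..real n} s * z s) \<partial>lborel)
        = ennreal (A (- real n) - A (real n))" for n :: nat
      by (rule nn_integral_has_integral_lebesgue[OF z(2) intz]) simp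
    ultimately have "(\<lambda>n::nat. ennreal (A (- real n) - A (real n))) \<longlonglongrightarrow> (\<integral>\<^sup>+s. ennreal (z s) \<partial>lborel)"
      by simp
    then show ?thesis using tendsto_ennrealI[OF lims] LIMSEQ_unique by blast
  qed
  have Aint: "A integrable_on {a..b}" for a b
  proof (rule bounded_borel_integrable_on)
    have "mono (\<lambda>s. - A s)" using anti by (auto simp: mono_def)
    then have "(\<lambda>s. - (- A s)) \<in> borel_measurable borel" by (intro borel_measurable_uminus borel_measurable_mono)
    then show "A \<in> borel_measurable borel" by simp
    show "\<bar>A x\<bar> \<le> \<eta> * M" for x using Abd[of x] by simp
  qed
  define B where "B = (\<Sum>i\<in>I. p i * (M * (\<tau> i)\<^sup>2))"
  \<comment> \<open>Up to a bounded error, averaging \<open>A\<close> amounts to averaging \<open>\<eta> * Z\<close>.\<close>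
  have Asum: "\<bar>integral {-T..0} A - \<eta> * integral {-T..0} Z\<bar> \<le> B" if T: "T > 0" for T
  proof -
    \<comment> \<open>Written as differences of the continuous function \<open>J\<close>, the inner integrals can be shifted without Fubini.\<close>
    define J where "J s = integral {-T..s} Z" for s
    have Jcont: "continuous_on {-T..b} J" for b unfolding J_def
      by (rule indefinite_integral_continuous_1[OF Zint])
    have Jint: "J integrable_on {a..b}" if "-T \<le> a" for a b
      by (rule integrable_continuous_interval, rule continuous_on_subset[OF Jcont[of b]]) (use that in auto)
    have Jdiff: "J (s + t) - J s = integral {s..s + t} Z" if "-T \<le> s" "0 \<le> t" for s t
      unfolding J_def
      using Henstock_Kurzweil_Integration.integral_combine[OF that(1) _ Zint, of "s+t"] that by simp
    have one: "((\<lambda>s. integral {s..s + \<tau> i} Z) has_integral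
            (integral {0..\<tau> i} J - integral {-T..-T + \<tau> i} J)) {-T..0}"
      "\<bar>(integral {0..\<tau> i} J - integral {-T..-T + \<tau> i} J) - \<tau> i * integral {-T..0} Z\<bar> \<le> M * (\<tau> i)\<^sup>2"
      if i: "i \<in> I" for i
    proof -
      have t: "\<tau> i > 0" using I(3) i by auto
      have shint: "(\<lambda>s. J (s + \<tau> i)) integrable_on {-T..0}"
        using integrable_shift_real_ivl[OF Jint[of "-T + \<tau> i" "\<tau> i"], of "\<tau> i"] t by simp
      have "((\<lambda>s. J (s + \<tau> i) - J s) has_integral
          (integral {-T..0} (\<lambda>s. J (s + \<tau> i)) - integral {-T..0} J)) {-T..0}"
        by (intro has_integral_diff integrable_integral shint Jint) auto
      moreover have "integral {-T..0} (\<lambda>s. J (s + \<tau> i)) - integral {-T..0} J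
          = integral {0..\<tau> i} J - integral {-T..-T + \<tau> i} J"
        using integral_minus_shifted_integral[of J "-T" 0 "\<tau> i"] Jint T t by simp
      ultimately show "((\<lambda>s. integral {s..s + \<tau> i} Z) has_integral
            (integral {0..\<tau> i} J - integral {-T..-T + \<tau> i} J)) {-T..0}"
        by (smt (verit) Jdiff t has_integral_cong atLeastAtMost_iff)
      have "0 \<le> J s \<and> J s \<le> \<tau> i * M" if "s \<in> {-T..-T+\<tau> i}" for s
      proof -
        have "(s - (-T)) * M \<le> \<tau> i * M" using that M by (intro mult_right_mono) auto
        then show ?thesis using Zbd[of "-T" s] that unfolding J_def by auto
      qed
      then have b1: "(-T + \<tau> i - -T) * 0 \<le> integral {-T..-T + \<tau> i} J"
         "integral {-T..-T + \<tau> i} J \<le> (-T + \<tau> i - -T) * (\<tau> i * M)"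
        by (intro integral_bounds_Icc[of J "-T" "-T + \<tau> i" 0 "\<tau> i * M"] Jint; use t in simp)+
      have "J 0 \<le> J s \<and> J s \<le> J 0 + \<tau> i * M" if "s \<in> {0..\<tau> i}" for s
      proof -
        have "s * M \<le> \<tau> i * M" using that M by (intro mult_right_mono) auto
        then show ?thesis using Zbd[of 0 s] Jdiff[of 0 s] that T by auto
      qed
      then have b2: "(\<tau> i - 0) * J 0 \<le> integral {0..\<tau> i} J"
         "integral {0..\<tau> i} J \<le> (\<tau> i - 0) * (J 0 + \<tau> i * M)"
        by (intro integral_bounds_Icc[of J 0 "\<tau> i" "J 0" "J 0 + \<tau> i * M"] Jint; use t T in simp)+
      have eq: "(-T + \<tau> i - -T) * 0 = 0" "(-T + \<tau> i - -T) * (\<tau> i * M) = M * (\<tau> i)\<^sup>2"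
        "(\<tau> i - 0) * J 0 = \<tau> i * J 0"
        "(\<tau> i - 0) * (J 0 + \<tau> i * M) = \<tau> i * J 0 + M * (\<tau> i)\<^sup>2"
        by (simp_all add: algebra_simps power2_eq_square)
      have J0: "J 0 = integral {-T..0} Z" by (simp add: J_def)
      show "\<bar>(integral {0..\<tau> i} J - integral {-T..-T + \<tau> i} J) - \<tau> i * integral {-T..0} Z\<bar> \<le> M * (\<tau> i)\<^sup>2"
        using b1 b2 unfolding eq J0[symmetric] by linarith
    qed
    have "(A has_integral (\<Sum>i\<in>I. p i * (integral {0..\<tau> i} J - integral {-T..-T + \<tau> i} J))) {-T..0}"
      unfolding A_def by (intro has_integral_sum I has_integral_mult_right one)
    then have eq: "integral {-T..0} A - \<eta> * integral {-T..0} Z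
       = (\<Sum>i\<in>I. p i * ((integral {0..\<tau> i} J - integral {-T..-T + \<tau> i} J) - \<tau> i * integral {-T..0} Z))"
      by (simp add: integral_unique \<eta>(1) right_diff_distrib sum_subtractf sum_distrib_right mult.assoc)
    show ?thesis unfolding eq B_def
    proof (rule sum_abs[THEN order_trans], rule sum_mono)
      fix i assume i: "i \<in> I"
      show "\<bar>p i * ((integral {0..\<tau> i} J - integral {-T..-T + \<tau> i} J) - \<tau> i * integral {-T..0} Z)\<bar>
          \<le> p i * (M * (\<tau> i)\<^sup>2)"
        unfolding abs_mult using I(3)[OF i] mult_left_mono[OF one(2)[OF i], of "p i"] by simp
    qed
  qed
  have "((\<lambda>T. 1 / T * integral {-T..0} A) \<longlongrightarrow> L) at_top" by (rule cesaro_mean_at_bot[OF Aint L(1)])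
  moreover have "((\<lambda>T. 1 / T * (integral {-T..0} A - \<eta> * integral {-T..0} Z)) \<longlongrightarrow> 0) at_top"
  proof (rule tendsto_0_le)
    show "((\<lambda>T::real. 1 / T) \<longlongrightarrow> 0) at_top"
      using tendsto_inverse_0_at_top[OF filterlim_ident] by (simp add: divide_inverse)
    show "\<forall>\<^sub>F T in at_top. norm (1 / T * (integral {-T..0} A - \<eta> * integral {-T..0} Z)) \<le> norm (1 / T) * B"
      using eventually_gt_at_top[of 0]
      by (rule eventually_mono) (use Asum in \<open>auto simp: abs_mult intro!: divide_right_mono\<close>)
  qed
  ultimately have "((\<lambda>T. (1 / T * integral {-T..0} A - 1 / T * (integral {-T..0} A - \<eta> * integral {-T..0} Z)) / \<eta>)
      \<longlongrightarrow> (L - 0) / \<eta>) at_top"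
    by (intro tendsto_divide tendsto_diff tendsto_const) (use \<eta>(2) in auto)
  moreover have eqT: "(1 / T * integral {-T..0} A - 1 / T * (integral {-T..0} A - \<eta> * integral {-T..0} Z)) / \<eta>
     = 1 / T * integral {-T..0} Z" for T
    using \<eta>(2) by (simp add: diff_divide_distrib)
  moreover have eqL: "(L - 0) / \<eta> = C / \<eta> + Zinf" using \<eta>(2) by (simp add: C_def field_simps)
  ultimately have "((\<lambda>T. 1 / T * integral {-T..0} Z) \<longlongrightarrow> C / \<eta> + Zinf) at_top"
    unfolding eqT eqL by blast
  then show thesis by (rule that[OF C0 nnz])
qed

section \<open>Similarities and Lebesgue measure\<close>

text \<open>After subtracting its value at \<open>0\<close> a similarity is linear, and an injective linear map of a finite-dimensional space into itself is onto.\<close>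

lemma similarity_bij:
  fixes f :: "'a::euclidean_space \<Rightarrow> 'a"
  assumes "c > 0" and f: "\<And>x y. dist (f x) (f y) = c * dist x y"
  shows "bij f"
proof -
  define g where "g x = f x - f 0" for x
  have "linear g"
    by (rule scaling_linear[where c=c]) (use f in \<open>auto simp: g_def dist_norm\<close>)
  moreover have "inj g"
  proof (rule injI)
    fix x y assume "g x = g y"
    then have "dist (f x) (f y) = 0" by (simp add: g_def)
    then show "x = y" using assms by simp
  qed
  ultimately have "surj g" by (simp add: linear_injective_imp_surjective)
  have "f = (\<lambda>v. v + f 0) \<circ> g" by (auto simp: g_def)
  moreover have "bij (\<lambda>v. v + f 0)" by (rule bij_plus_right)
  ultimately show ?thesis using \<open>inj g\<close> \<open>surj g\<close> by (metis bij_comp bijI)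
qed

lemma similarity_inv:
  fixes f :: "'a::euclidean_space \<Rightarrow> 'a"
  assumes "c > 0" and f: "\<And>x y. dist (f x) (f y) = c * dist x y"
  shows "dist (inv f x) (inv f y) = (1 / c) * dist x y"
proof -
  have "surj f" using similarity_bij[OF assms] by (rule bij_is_surj)
  then have "dist x y = c * dist (inv f x) (inv f y)"
    using f[of "inv f x" "inv f y"] by (simp add: surj_f_inv_f)
  then show ?thesis using assms(1) by simp
qed

lemma similarity_homeomorphism:
  fixes f :: "'a::euclidean_space \<Rightarrow> 'a"
  assumes "c > 0" and f: "\<And>x y. dist (f x) (f y) = c * dist x y"
  shows "homeomorphism UNIV UNIV f (inv f)"
proof -
  have lip: "continuous_on UNIV g" if "\<And>x y. dist (g x) (g y) = k * dist x y" "k > 0"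
    for g :: "'a \<Rightarrow> 'a" and k
    using that by (intro lipschitz_on_continuous_on[of k] lipschitz_onI) auto
  note bij = similarity_bij[OF assms]
  show ?thesis
    using lip[OF f assms(1)] lip[OF similarity_inv[OF assms]] assms(1) bij
    by (auto simp: homeomorphism_def bij_is_inj bij_is_surj surj_f_inv_f bij_imp_bij_inv)
qed

lemma similarity_compact_image:
  fixes f :: "'a::euclidean_space \<Rightarrow> 'a"
  assumes "c > 0" and f: "\<And>x y. dist (f x) (f y) = c * dist x y" and "compact A"
  shows "compact (f ` A)"
proof (rule compact_continuous_image)
  have "continuous_on UNIV f" using similarity_homeomorphism[OF assms(1,2)] by (simp add: homeomorphism_def)
  then show "continuous_on A f" by (rule continuous_on_subset) simp
qed (rule assms(3))

lemma similarity_image_ball: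
  fixes f :: "'a::euclidean_space \<Rightarrow> 'a"
  assumes "c > 0" and f: "\<And>x y. dist (f x) (f y) = c * dist x y"
  shows "f ` ball x e = ball (f x) (c * e)"
proof -
  note bij = similarity_bij[OF assms]
  have "y \<in> f ` ball x e" if "y \<in> ball (f x) (c * e)" for y
  proof -
    obtain z where z: "y = f z" using bij by (meson bij_pointE)
    then have "c * dist x z < c * e" using that f by simp
    then show ?thesis using z assms(1) by simp
  qed
  moreover have "f ` ball x e \<subseteq> ball (f x) (c * e)" using assms(1) by (auto simp: f)
  ultimately show ?thesis by blast
qed

lemma similarity_infdist:
  fixes f :: "'a::euclidean_space \<Rightarrow> 'a"
  assumes "c > 0" and f: "\<And>x y. dist (f x) (f y) = c * dist x y"
  shows "infdist (f x) (f ` A) = c * infdist x A"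
proof (cases "A = {}")
  case False
  show ?thesis
  proof (rule antisym)
    have "infdist (f x) (f ` A) / c \<le> infdist x A" unfolding infdist_notempty[OF False]
    proof (rule cINF_greatest[OF False])
      fix y assume "y \<in> A"
      then have "infdist (f x) (f ` A) \<le> c * dist x y" using infdist_le[of "f y" "f ` A" "f x"] by (simp add: f)
      then show "infdist (f x) (f ` A) / c \<le> dist x y" using assms(1) by (simp add: field_simps)
    qed
    then show "infdist (f x) (f ` A) \<le> c * infdist x A" using assms(1) by (simp add: field_simps)
    have ne: "f ` A \<noteq> {}" using False by simp
    show "c * infdist x A \<le> infdist (f x) (f ` A)" unfolding infdist_notempty[OF ne]
      by (rule cINF_greatest[OF ne]) (use assms(1) in \<open>auto simp: f infdist_le\<close>)
  qed
qed (simp add: infdist_def)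

lemma similarity_parallel_set:
  fixes f :: "'a::euclidean_space \<Rightarrow> 'a"
  assumes "c > 0" and f: "\<And>x y. dist (f x) (f y) = c * dist x y"
  shows "parallel_set (f ` A) \<epsilon> = f ` parallel_set A (\<epsilon> / c)"
proof -
  have "f z \<in> parallel_set (f ` A) \<epsilon> \<longleftrightarrow> z \<in> parallel_set A (\<epsilon> / c)" for z
    using assms(1) by (simp add: parallel_set_def similarity_infdist[OF assms] field_simps)
  moreover have "parallel_set (f ` A) \<epsilon> \<subseteq> range f" using similarity_bij[OF assms] by (simp add: bij_is_surj)
  ultimately show ?thesis by auto
qed

text \<open>By Vitali's covering theorem an open set is, up to a null set, a disjoint union of balls, and a similarity maps balls to balls of known volume.\<close>

lemma similarity_emeasure_open_le:
  fixes f :: "'a::euclidean_space \<Rightarrow> 'a"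
  assumes "c > 0" and f: "\<And>x y. dist (f x) (f y) = c * dist x y" and "open U"
  shows "ennreal (c ^ DIM('a)) * emeasure lebesgue U \<le> emeasure lebesgue (f ` U)"
proof -
  define K where "K = {(x, e). 0 < e \<and> ball x e \<subseteq> U}"
  obtain C where C: "countable C" "C \<subseteq> K"
     "pairwise (\<lambda>i j. disjnt (ball (fst i) (snd i)) (ball (fst j) (snd j))) C"
     "negligible (U - (\<Union>i \<in> C. ball (fst i) (snd i)))"
  proof (rule Vitali_covering_theorem_balls[of U K fst snd])
    fix x and d :: real assume "x \<in> U" "0 < d"
    then obtain e where e: "e > 0" "ball x e \<subseteq> U" using \<open>open U\<close> openE by blast
    have "ball x (min e (d/2)) \<subseteq> U" using e by auto
    then show "\<exists>i. i \<in> K \<and> x \<in> ball (fst i) (snd i) \<and> snd i < d"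
      using e \<open>0 < d\<close> by (intro exI[of _ "(x, min e (d/2))"]) (auto simp: K_def)
  qed blast
  let ?B = "\<lambda>i. ball (fst i) (snd i)"
  have inj: "inj f" using similarity_bij[OF assms(1,2)] by (rule bij_is_inj)
  have img: "f ` ?B i = ball (f (fst i)) (c * snd i)" for i
    by (rule similarity_image_ball[OF assms(1,2)])
  have disj1: "disjoint_family_on ?B C"
    using C(3) by (auto simp: disjoint_family_on_def pairwise_def disjnt_def)
  have disj: "disjoint_family_on ?B C" "disjoint_family_on (\<lambda>i. f ` ?B i) C"
    using disj1 unfolding disjoint_family_on_def image_Int[OF inj, symmetric] by simp_all
  have "?B i \<subseteq> U" if "i \<in> C" for i using C(2) that unfolding K_def by (cases i) auto
  then have sub: "(\<Union>i\<in>C. ?B i) \<subseteq> U" by (rule UN_least)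
  have "emeasure lebesgue U \<le> emeasure lebesgue ((\<Union>i\<in>C. ?B i) \<union> (U - (\<Union>i \<in> C. ?B i)))"
  proof (rule emeasure_mono)
    have "open ((\<Union>i\<in>C. ?B i) \<union> U)" using \<open>open U\<close> by (intro open_Un open_UN) auto
    then show "(\<Union>i\<in>C. ?B i) \<union> (U - (\<Union>i \<in> C. ?B i)) \<in> sets lebesgue" by simp
  qed auto
  also have "\<dots> = emeasure lebesgue (\<Union>i\<in>C. ?B i)"
  proof (rule emeasure_Un_null_set)
    have "open (\<Union>i\<in>C. ?B i)" by (intro open_UN) auto
    then show "(\<Union>i\<in>C. ?B i) \<in> sets lebesgue" by simp
  qed (use C(4) in \<open>simp add: negligible_iff_null_sets\<close>)
  also have "\<dots> = (\<integral>\<^sup>+i. emeasure lebesgue (?B i) \<partial>count_space C)"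
    by (rule emeasure_UN_countable) (use C disj in auto)
  finally have "ennreal (c ^ DIM('a)) * emeasure lebesgue U
      \<le> ennreal (c ^ DIM('a)) * (\<integral>\<^sup>+i. emeasure lebesgue (?B i) \<partial>count_space C)"
    by (rule mult_left_mono) simp
  also have "\<dots> = (\<integral>\<^sup>+i. ennreal (c ^ DIM('a)) * emeasure lebesgue (?B i) \<partial>count_space C)"
    by (simp add: nn_integral_cmult)
  also have "\<dots> = (\<integral>\<^sup>+i. emeasure lebesgue (f ` ?B i) \<partial>count_space C)"
  proof (rule nn_integral_cong)
    fix i assume "i \<in> space (count_space C)"
    then have e: "snd i > 0" using C(2) by (auto simp: K_def)
    show "ennreal (c ^ DIM('a)) * emeasure lebesgue (?B i) = emeasure lebesgue (f ` ?B i)"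
      unfolding img using e assms(1)
      by (subst (1 2) emeasure_lebesgue_ball_conv_unit_ball)
         (auto simp: power_mult_distrib ennreal_mult mult.assoc)
  qed
  also have "\<dots> = emeasure lebesgue (\<Union>i\<in>C. f ` ?B i)"
    by (rule emeasure_UN_countable[symmetric]) (use C disj img in auto)
  also have "\<dots> \<le> emeasure lebesgue (f ` U)"
  proof (rule emeasure_mono)
    show "(\<Union>i\<in>C. f ` ?B i) \<subseteq> f ` U" using sub by blast
    have "open (f ` U)"
      using homeomorphism_imp_open_map[OF similarity_homeomorphism[OF assms(1,2)], of U] \<open>open U\<close> by simp
    then show "f ` U \<in> sets lebesgue" by simp
  qed
  finally show ?thesis .
qed

lemma similarity_open_image:
  fixes f :: "'a::euclidean_space \<Rightarrow> 'a"
  assumes "c > 0" and f: "\<And>x y. dist (f x) (f y) = c * dist x y"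
  shows "open (f ` U) \<longleftrightarrow> open U"
  using homeomorphism_imp_open_map[OF similarity_homeomorphism[OF assms], of U]
    homeomorphism_imp_open_map[OF homeomorphism_symD[OF similarity_homeomorphism[OF assms]], of "f ` U"]
    similarity_bij[OF assms] by (auto simp: bij_is_inj image_inv_f_f)

text \<open>The reverse inequality is the same lemma for the inverse similarity.\<close>

lemma similarity_emeasure_open:
  fixes f :: "'a::euclidean_space \<Rightarrow> 'a"
  assumes "c > 0" and f: "\<And>x y. dist (f x) (f y) = c * dist x y" and "open U"
  shows "emeasure lebesgue (f ` U) = ennreal (c ^ DIM('a)) * emeasure lebesgue U"
proof (rule antisym)
  have "ennreal ((1/c) ^ DIM('a)) * emeasure lebesgue (f ` U) \<le> emeasure lebesgue (inv f ` f ` U)"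
    by (rule similarity_emeasure_open_le[OF _ similarity_inv[OF assms(1,2)]])
       (use assms similarity_open_image[OF assms(1,2), of U] in auto)
  also have "inv f ` f ` U = U" using similarity_bij[OF assms(1,2)] by (simp add: bij_is_inj image_inv_f_f)
  finally have "ennreal (c ^ DIM('a)) * (ennreal ((1/c) ^ DIM('a)) * emeasure lebesgue (f ` U))
     \<le> ennreal (c ^ DIM('a)) * emeasure lebesgue U" by (rule mult_left_mono) simp
  moreover have "ennreal (c ^ DIM('a)) * ennreal ((1/c) ^ DIM('a)) = 1"
    using assms(1) by (simp add: ennreal_mult[symmetric] power_mult_distrib[symmetric])
  ultimately show "emeasure lebesgue (f ` U) \<le> ennreal (c ^ DIM('a)) * emeasure lebesgue U"
    by (simp add: mult.assoc[symmetric])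
qed (rule similarity_emeasure_open_le[OF assms])

lemma similarity_borel_image:
  fixes f :: "'a::euclidean_space \<Rightarrow> 'a"
  assumes "c > 0" and f: "\<And>x y. dist (f x) (f y) = c * dist x y" and "A \<in> sets borel"
  shows "f ` A \<in> sets borel"
proof -
  have "continuous_on UNIV (inv f)" using similarity_homeomorphism[OF assms(1,2)] by (simp add: homeomorphism_def)
  then have "inv f \<in> borel_measurable borel" by (rule borel_measurable_continuous_onI)
  then have "inv f -` A \<inter> space borel \<in> sets borel" using assms(3) by (rule measurable_sets)
  moreover have "f ` A = inv f -` A" using similarity_bij[OF assms(1,2)] by (simp add: bij_vimage_eq_inv_image bij_imp_bij_inv inv_inv_eq)
  ultimately show ?thesis by simp
qed

text \<open>Outer regularity passes from open sets to Borel sets.\<close>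

lemma similarity_emeasure_le:
  fixes f :: "'a::euclidean_space \<Rightarrow> 'a"
  assumes "c > 0" and f: "\<And>x y. dist (f x) (f y) = c * dist x y" and A: "A \<in> sets borel"
  shows "emeasure lebesgue (f ` A) \<le> ennreal (c ^ DIM('a)) * emeasure lebesgue A"
proof (rule ennreal_le_epsilon)
  fix e :: real assume e: "e > 0"
  \<comment> \<open>The image of the part of \<open>U\<close> outside of \<open>A\<close> then has volume at most \<open>e\<close>.\<close>
  define e' where "e' = e / c ^ DIM('a)"
  have e': "e' > 0" using e assms(1) by (simp add: e'_def)
  obtain U where U: "open U" "A \<subseteq> U" "(U - A) \<in> lmeasurable" "emeasure lebesgue (U - A) < ennreal e'"
    using sets_lebesgue_outer_open[of A e'] A e' by auto
  have "emeasure lebesgue (f ` A) \<le> emeasure lebesgue (f ` U)"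
    using U similarity_open_image[OF assms(1,2), of U] by (intro emeasure_mono) auto
  also have "\<dots> = ennreal (c ^ DIM('a)) * emeasure lebesgue U"
    by (rule similarity_emeasure_open[OF assms(1,2) U(1)])
  also have "emeasure lebesgue U = emeasure lebesgue (A \<union> (U - A))" using U(2) by (simp add: Un_absorb1)
  also have "\<dots> \<le> emeasure lebesgue A + emeasure lebesgue (U - A)"
    using A U by (intro emeasure_subadditive) auto
  also have "\<dots> \<le> emeasure lebesgue A + ennreal e'" using U(4) by (intro add_left_mono) simp
  also have "ennreal (c ^ DIM('a)) * (emeasure lebesgue A + ennreal e')
     = ennreal (c ^ DIM('a)) * emeasure lebesgue A + ennreal e"
    using assms(1) e by (simp add: distrib_left ennreal_mult[symmetric] e'_def)
  finally show "emeasure lebesgue (f ` A) \<le> ennreal (c ^ DIM('a)) * emeasure lebesgue A + ennreal e"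
    by (simp add: mult_left_mono)
qed

lemma similarity_emeasure:
  fixes f :: "'a::euclidean_space \<Rightarrow> 'a"
  assumes "c > 0" and f: "\<And>x y. dist (f x) (f y) = c * dist x y" and A: "A \<in> sets borel"
  shows "emeasure lebesgue (f ` A) = ennreal (c ^ DIM('a)) * emeasure lebesgue A"
proof (rule antisym)
  have "emeasure lebesgue (inv f ` f ` A) \<le> ennreal ((1/c) ^ DIM('a)) * emeasure lebesgue (f ` A)"
    by (rule similarity_emeasure_le[OF _ similarity_inv[OF assms(1,2)]])
       (use assms similarity_borel_image[OF assms] in auto)
  also have "inv f ` f ` A = A" using similarity_bij[OF assms(1,2)] by (simp add: bij_is_inj image_inv_f_f)
  finally have "ennreal (c ^ DIM('a)) * emeasure lebesgue A
     \<le> ennreal (c ^ DIM('a)) * (ennreal ((1/c) ^ DIM('a)) * emeasure lebesgue (f ` A))" by (rule mult_left_mono) simp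
  moreover have "ennreal (c ^ DIM('a)) * ennreal ((1/c) ^ DIM('a)) = 1"
    using assms(1) by (simp add: ennreal_mult[symmetric] power_mult_distrib[symmetric])
  ultimately show "ennreal (c ^ DIM('a)) * emeasure lebesgue A \<le> emeasure lebesgue (f ` A)"
    by (simp add: mult.assoc[symmetric])
qed (rule similarity_emeasure_le[OF assms])

lemma similarity_measure:
  fixes f :: "'a::euclidean_space \<Rightarrow> 'a"
  assumes "c > 0" and f: "\<And>x y. dist (f x) (f y) = c * dist x y" and A: "A \<in> sets borel"
  shows "measure lebesgue (f ` A) = c ^ DIM('a) * measure lebesgue A"
  using similarity_emeasure[OF assms] assms(1) by (simp add: measure_def enn2real_mult)

section \<open>Parallel sets, nearest points, logarithmic substitution\<close>

lemma closed_parallel_set: "closed (parallel_set A \<epsilon>)"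
  unfolding parallel_set_def by (intro closed_Collect_le continuous_intros)

lemma borel_parallel_set: "parallel_set A \<epsilon> \<in> sets borel"
  using closed_parallel_set by (rule borel_closed)

lemma bounded_parallel_set:
  assumes "bounded A" "A \<noteq> {}"
  shows "bounded (parallel_set A \<epsilon>)"
proof -
  obtain a R where R: "\<And>y. y \<in> A \<Longrightarrow> dist a y \<le> R" using assms(1) by (auto simp: bounded_def)
  have "dist a z \<le> R + (\<epsilon> + 1)" if "z \<in> parallel_set A \<epsilon>" for z
  proof -
    have "infdist z A < \<epsilon> + 1" using that by (simp add: parallel_set_def)
    then obtain y where "y \<in> A" "dist z y < \<epsilon> + 1"
      using assms(2) cInf_lessD[of "dist z ` A"] by (auto simp: infdist_notempty)
    then show ?thesis using R[of y] dist_triangle[of a z y] by (simp add: dist_commute)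
  qed
  then show ?thesis by (auto simp: bounded_def)
qed

lemma lmeasurable_parallel_set_Int:
  assumes "bounded A" "A \<noteq> {}" "W \<in> sets borel"
  shows "parallel_set A \<epsilon> \<inter> W \<in> lmeasurable"
proof (rule bounded_set_imp_lmeasurable)
  show "bounded (parallel_set A \<epsilon> \<inter> W)" using bounded_parallel_set[OF assms(1,2)] by (meson bounded_Int)
  have "parallel_set A \<epsilon> \<inter> W \<in> sets borel" using assms(3) borel_parallel_set by (rule sets.Int[rotated])
  then show "parallel_set A \<epsilon> \<inter> W \<in> sets lebesgue" by simp
qed

definition parallel_volume :: "'a::euclidean_space set \<Rightarrow> 'a set \<Rightarrow> real \<Rightarrow> real" where
  "parallel_volume A W \<epsilon> = measure lebesgue (parallel_set A \<epsilon> \<inter> W)"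

lemma emeasure_parallel_set:
  assumes "bounded A" "A \<noteq> {}" "W \<in> sets borel"
  shows "emeasure lebesgue (parallel_set A \<epsilon> \<inter> W) = ennreal (parallel_volume A W \<epsilon>)"
  unfolding parallel_volume_def
  using emeasure_eq_measure2[OF lmeasurable_parallel_set_Int[OF assms]] .

lemma parallel_volume_nonneg [simp]: "0 \<le> parallel_volume A W \<epsilon>"
  by (simp add: parallel_volume_def)

lemma parallel_volume_mono:
  assumes "bounded A" "A \<noteq> {}" "W \<in> sets borel" "W' \<in> sets borel" "W \<subseteq> W'" "\<epsilon> \<le> \<epsilon>'"
  shows "parallel_volume A W \<epsilon> \<le> parallel_volume A W' \<epsilon>'"
  unfolding parallel_volume_def
proof (rule measure_mono_fmeasurable)
  show "parallel_set A \<epsilon> \<inter> W \<subseteq> parallel_set A \<epsilon>' \<inter> W'" using assms(5,6) by (auto simp: parallel_set_def)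
qed (use lmeasurable_parallel_set_Int assms in \<open>auto intro: fmeasurableD\<close>)

lemma parallel_volume_measurable [measurable]:
  assumes "bounded A" "A \<noteq> {}" "W \<in> sets borel"
  shows "parallel_volume A W \<in> borel_measurable borel"
  by (intro borel_measurable_mono monoI parallel_volume_mono assms order_refl)

lemma parallel_volume_Un:
  assumes "bounded A" "A \<noteq> {}" "W \<in> sets borel" "W' \<in> sets borel" "W \<inter> W' = {}"
  shows "parallel_volume A (W \<union> W') \<epsilon> = parallel_volume A W \<epsilon> + parallel_volume A W' \<epsilon>"
  unfolding parallel_volume_def Int_Un_distrib
  by (rule measure_Un3[THEN trans])
     (use assms lmeasurable_parallel_set_Int in \<open>auto simp: Int_assoc Int_left_commute\<close>)

lemma parallel_volume_UN:
  assumes "bounded A" "A \<noteq> {}" "finite I" "\<And>i. i \<in> I \<Longrightarrow> W i \<in> sets borel" "disjoint_family_on W I"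
  shows "parallel_volume A (\<Union>i\<in>I. W i) \<epsilon> = (\<Sum>i\<in>I. parallel_volume A (W i) \<epsilon>)"
  unfolding parallel_volume_def Int_UN_distrib
proof (rule measure_finite_Union[OF \<open>finite I\<close>])
  show "disjoint_family_on (\<lambda>i. parallel_set A \<epsilon> \<inter> W i) I"
    using assms(5) by (auto simp: disjoint_family_on_def)
  have m: "parallel_set A \<epsilon> \<inter> W i \<in> lmeasurable" if "i \<in> I" for i
    by (rule lmeasurable_parallel_set_Int[OF assms(1,2) assms(4)[OF that]])
  then show "(\<lambda>i. parallel_set A \<epsilon> \<inter> W i) ` I \<subseteq> sets lebesgue" by blast
  show "emeasure lebesgue (parallel_set A \<epsilon> \<inter> W i) \<noteq> \<infinity>" if "i \<in> I" for i
    using fmeasurableD2[OF m[OF that]] unfolding infinity_ennreal_def .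
qed

lemma parallel_volume_similarity:
  fixes f :: "'a::euclidean_space \<Rightarrow> 'a"
  assumes "c > 0" and f: "\<And>x y. dist (f x) (f y) = c * dist x y" and W: "W \<in> sets borel"
  shows "parallel_volume (f ` A) (f ` W) \<epsilon> = c ^ DIM('a) * parallel_volume A W (\<epsilon> / c)"
proof -
  have "inj f" using similarity_bij[OF assms(1,2)] by (rule bij_is_inj)
  then have "parallel_set (f ` A) \<epsilon> \<inter> f ` W = f ` (parallel_set A (\<epsilon> / c) \<inter> W)"
    by (simp add: similarity_parallel_set[OF assms(1,2)] image_Int)
  moreover have "parallel_set A (\<epsilon> / c) \<inter> W \<in> sets borel" using W borel_parallel_set by (rule sets.Int[rotated])
  ultimately show ?thesis
    unfolding parallel_volume_def using similarity_measure[OF assms(1,2)] by simp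
qed

text \<open>The distance to a finite union of compact sets is attained in one of them.\<close>

lemma parallel_set_UN_subset:
  assumes "finite I" "I \<noteq> {}" "\<And>i. i \<in> I \<Longrightarrow> compact (A i)" "\<And>i. i \<in> I \<Longrightarrow> A i \<noteq> {}"
  shows "parallel_set (\<Union>i\<in>I. A i) \<epsilon> \<subseteq> (\<Union>i\<in>I. parallel_set (A i) \<epsilon>)"
proof
  fix z assume z: "z \<in> parallel_set (\<Union>i\<in>I. A i) \<epsilon>"
  have "closed (\<Union>i\<in>I. A i)" using assms by (intro closed_UN) (auto intro: compact_imp_closed)
  then obtain y where y: "y \<in> (\<Union>i\<in>I. A i)" "infdist z (\<Union>i\<in>I. A i) = dist z y"
    by (rule infdist_attains_inf) (use assms in auto)
  then obtain i where i: "i \<in> I" "y \<in> A i" by blast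
  then have "infdist z (A i) \<le> dist z y" using infdist_le by blast
  then have "z \<in> parallel_set (A i) \<epsilon>" using y z by (simp add: parallel_set_def)
  then show "z \<in> (\<Union>i\<in>I. parallel_set (A i) \<epsilon>)" using i by blast
qed

lemma parallel_volume_UN_left:
  assumes "finite I" "I \<noteq> {}" "\<And>i. i \<in> I \<Longrightarrow> compact (A i)" "\<And>i. i \<in> I \<Longrightarrow> A i \<noteq> {}" "W \<in> sets borel"
  shows "parallel_volume (\<Union>i\<in>I. A i) W \<epsilon> \<le> (\<Sum>i\<in>I. parallel_volume (A i) W \<epsilon>)"
proof -
  have m: "parallel_set (A i) \<epsilon> \<inter> W \<in> lmeasurable" if "i \<in> I" for i
    using that assms by (intro lmeasurable_parallel_set_Int) (auto intro: compact_imp_bounded)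
  have b: "bounded (\<Union>i\<in>I. A i)" "(\<Union>i\<in>I. A i) \<noteq> {}" using assms by (auto intro!: bounded_UN compact_imp_bounded)
  have "parallel_volume (\<Union>i\<in>I. A i) W \<epsilon> \<le> measure lebesgue (\<Union>i\<in>I. parallel_set (A i) \<epsilon> \<inter> W)"
    unfolding parallel_volume_def
  proof (rule measure_mono_fmeasurable)
    show "parallel_set (\<Union>i\<in>I. A i) \<epsilon> \<inter> W \<subseteq> (\<Union>i\<in>I. parallel_set (A i) \<epsilon> \<inter> W)"
      using parallel_set_UN_subset[of I A, OF assms(1-4)] by blast
    show "(\<Union>i\<in>I. parallel_set (A i) \<epsilon> \<inter> W) \<in> lmeasurable"
      using assms(1) m by (intro fmeasurable.finite_UN) auto
  qed (rule fmeasurableD[OF lmeasurable_parallel_set_Int[OF b assms(5)]])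
  also have "\<dots> \<le> (\<Sum>i\<in>I. parallel_volume (A i) W \<epsilon>)"
    unfolding parallel_volume_def by (rule measure_UNION_le) (use assms m in \<open>auto intro: fmeasurableD\<close>)
  finally show ?thesis .
qed

lemma infdist_eq_dist_iff:
  fixes A :: "'a::heine_borel set"
  assumes "closed A" "A \<noteq> {}" "y \<in> A"
  shows "infdist x A = dist x y \<longleftrightarrow> (\<forall>z\<in>A. dist x y \<le> dist x z)"
proof
  assume "infdist x A = dist x y" then show "\<forall>z\<in>A. dist x y \<le> dist x z" by (metis infdist_le)
next
  assume le: "\<forall>z\<in>A. dist x y \<le> dist x z"
  obtain z where "z \<in> A" "infdist x A = dist x z" by (rule infdist_attains_inf[OF assms(1,2)])
  then show "infdist x A = dist x y" using le infdist_le[OF assms(3), of x] by force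
qed

text \<open>If a nearest point \<open>y\<close> of \<open>x\<close> lies in \<open>B\<close>, then every point of the segment from \<open>x\<close> to \<open>y\<close>, except
  possibly \<open>x\<close>, has \<open>y\<close> as its only nearest point, by strict convexity of the balls. Conversely the two
  distances agree on the projection preimage and are continuous.\<close>

lemma closure_projection_preimage:
  fixes A B :: "'a::euclidean_space set"
  assumes A: "closed A" and B: "closed B" "B \<noteq> {}" "B \<subseteq> A"
  shows "x \<in> closure (projection_preimage A B) \<longleftrightarrow> infdist x A = infdist x B"
proof
  have A0: "A \<noteq> {}" using B by auto
  have "infdist x A = infdist x B" if "x \<in> projection_preimage A B" for x
  proof -
    have c: "closest_point A x \<in> B" using that by (simp add: projection_preimage_def)
    have "infdist x A = dist x (closest_point A x)"
      using closest_point_exists[OF A A0, of x] infdist_eq_dist_iff[OF A A0] by blast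
    then show ?thesis using infdist_le[OF c, of x] infdist_mono[OF B(3,2), of x] by linarith
  qed
  then have sub: "projection_preimage A B \<subseteq> {x. infdist x A = infdist x B}" by blast
  have "closed {x. infdist x A = infdist x B}" by (intro closed_Collect_eq continuous_intros)
  then have "closure (projection_preimage A B) \<subseteq> {x. infdist x A = infdist x B}"
    using sub by (rule closure_minimal[rotated])
  then show "infdist x A = infdist x B" if "x \<in> closure (projection_preimage A B)" using that by blast
next
  assume eq: "infdist x A = infdist x B"
  have A0: "A \<noteq> {}" using B by auto
  obtain y where y: "y \<in> B" "infdist x B = dist x y" by (rule infdist_attains_inf[OF B(1,2)])
  have yA: "y \<in> A" using y B by auto
  have near: "dist x y \<le> dist x z" if "z \<in> A" for z using infdist_le[OF that, of x] eq y by simp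
  have mem: "x + t *\<^sub>R (y - x) \<in> projection_preimage A B" if t: "0 < t" "t \<le> 1" for t
  proof -
    define w where "w = x + t *\<^sub>R (y - x)"
    have wy: "dist w y = (1 - t) * dist x y"
    proof -
      have "w - y = (1 - t) *\<^sub>R (x - y)" by (simp add: w_def algebra_simps)
      then show ?thesis using t by (simp add: dist_norm)
    qed
    have xw: "dist x w = t * dist x y" using t by (simp add: w_def dist_norm norm_minus_commute)
    have uniq: "z = y" if z: "z \<in> A" "dist w z \<le> dist w y" for z
    proof -
      \<comment> \<open>Equality in the triangle inequality puts \<open>z\<close> on the ray from \<open>x\<close> through \<open>w\<close>, at the distance of \<open>y\<close>.\<close>
      have e: "dist x z = dist x w + dist w z" "dist w z = dist w y"
        using near[OF z(1)] dist_triangle[of x z w] z(2) wy xw by (auto simp: algebra_simps)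
      show ?thesis
      proof (cases "x = y")
        case True then show ?thesis using e wy xw by (simp add: w_def)
      next
        case False
        have "norm ((x - w) + (w - z)) = norm (x - w) + norm (w - z)" using e by (simp add: dist_norm)
        then have "norm (x - w) *\<^sub>R (w - z) = norm (w - z) *\<^sub>R (x - w)" using norm_triangle_eq by blast
        then have "(t * dist x y) *\<^sub>R (w - z) = ((1 - t) * dist x y) *\<^sub>R (- (t *\<^sub>R (y - x)))"
          using e wy xw by (simp add: dist_norm) (simp add: w_def)
        then have "(t * dist x y) *\<^sub>R (w - z) = (t * dist x y) *\<^sub>R ((1 - t) *\<^sub>R (x - y))"
          by (simp add: algebra_simps)
        then have "t * dist x y = 0 \<or> w - z = (1 - t) *\<^sub>R (x - y)" by (simp only: scaleR_cancel_left) blast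
        then have "w - z = (1 - t) *\<^sub>R (x - y)" using t False by simp
        then show ?thesis by (simp add: w_def algebra_simps)
      qed
    qed
    have min: "\<forall>z\<in>A. dist w y \<le> dist w z" using uniq by force
    have "w \<in> unique_nearest_points A" unfolding unique_nearest_points_def
      using yA min uniq by blast
    moreover have "closest_point A w = y"
      using closest_point_exists[OF A A0, of w] uniq yA by blast
    ultimately show ?thesis using y by (simp add: projection_preimage_def w_def)
  qed
  show "x \<in> closure (projection_preimage A B)"
  proof (rule closure_sequential[THEN iffD2], intro exI conjI allI)
    show "x + (1 / real (Suc n)) *\<^sub>R (y - x) \<in> projection_preimage A B" for n by (rule mem) auto
    have "(\<lambda>n. x + (1 / real (Suc n)) *\<^sub>R (y - x)) \<longlonglongrightarrow> x + 0 *\<^sub>R (y - x)"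
      using LIMSEQ_inverse_real_of_nat unfolding inverse_eq_divide by (intro tendsto_intros)
    then show "(\<lambda>n. x + (1 / real (Suc n)) *\<^sub>R (y - x)) \<longlonglongrightarrow> x" by simp
  qed
qed

text \<open>The substitution \<open>\<epsilon> = exp s\<close> turns the scaling by ratios into shifts.\<close>

lemma nn_integral_exp_substitution:
  fixes h :: "real \<Rightarrow> ennreal"
  assumes [measurable]: "h \<in> borel_measurable borel"
  shows "(\<integral>\<^sup>+\<epsilon>\<in>{0<..}. h \<epsilon> \<partial>lborel) = (\<integral>\<^sup>+s. h (exp s) * ennreal (exp s) \<partial>lborel)"
proof -
  let ?J = "\<lambda>n. {- real (Suc n)..real (Suc n)}"
  have ind: "(indicator X x :: ennreal) \<le> indicator Y x" if "X \<subseteq> Y" for X Y :: "real set" and x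
    using that by (auto simp: indicator_def)
  have *: "(\<integral>\<^sup>+\<epsilon>. h \<epsilon> * indicator {exp (- real (Suc n))..exp (real (Suc n))} \<epsilon> \<partial>lborel)
      = (\<integral>\<^sup>+s. h (exp s) * ennreal (exp s) * indicator (?J n) s \<partial>lborel)" for n
    by (rule nn_integral_substitution_aux)
       (auto intro!: continuous_intros derivative_eq_intros)
  have ev: "\<forall>\<^sub>F n in sequentially. \<bar>s\<bar> \<le> real (Suc n)" for s :: real
  proof -
    obtain n0 :: nat where "\<bar>s\<bar> \<le> real n0" using real_arch_simple by blast
    then show ?thesis unfolding eventually_sequentially by (intro exI[of _ n0]) auto
  qed
  have "(\<lambda>n. \<integral>\<^sup>+\<epsilon>. h \<epsilon> * indicator {exp (- real (Suc n))..exp (real (Suc n))} \<epsilon> \<partial>lborel)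
     \<longlonglongrightarrow> (\<integral>\<^sup>+\<epsilon>\<in>{0<..}. h \<epsilon> \<partial>lborel)"
  proof (rule nn_integral_LIMSEQ)
    show "(\<lambda>n. h \<epsilon> * indicator {exp (- real (Suc n))..exp (real (Suc n))} \<epsilon>) \<longlonglongrightarrow> h \<epsilon> * indicator {0<..} \<epsilon>" for \<epsilon>
    proof (cases "\<epsilon> > 0")
      case True
      show ?thesis
      proof (rule tendsto_eventually, rule eventually_mono[OF ev[of "ln \<epsilon>"]])
        fix n assume n: "\<bar>ln \<epsilon>\<bar> \<le> real (Suc n)"
        have "exp (ln \<epsilon>) \<le> exp (real (Suc n))" "exp (- real (Suc n)) \<le> exp (ln \<epsilon>)"
          using n unfolding exp_le_cancel_iff by linarith+
        then show "h \<epsilon> * indicator {exp (- real (Suc n))..exp (real (Suc n))} \<epsilon> = h \<epsilon> * indicator {0<..} \<epsilon>"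
          using True by simp
      qed
    next
      case False
      then have "\<epsilon> \<notin> {exp (- real (Suc n))..exp (real (Suc n))}" for n
        using exp_gt_zero[of "- real (Suc n)"] by (auto simp del: exp_gt_zero)
      then show ?thesis using False by simp
    qed
    have sub: "{exp (- real (Suc m))..exp (real (Suc m))} \<subseteq> {exp (- real (Suc n))..exp (real (Suc n))}"
      if "m \<le> n" for m n using that unfolding atLeastatMost_subset_iff by simp
    show "incseq (\<lambda>n \<epsilon>. h \<epsilon> * indicator {exp (- real (Suc n))..exp (real (Suc n))} \<epsilon>)"
      unfolding incseq_def le_fun_def by (intro allI impI mult_left_mono ind sub) simp_all
  qed simp
  moreover have "(\<lambda>n. \<integral>\<^sup>+s. h (exp s) * ennreal (exp s) * indicator (?J n) s \<partial>lborel)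
     \<longlonglongrightarrow> (\<integral>\<^sup>+s. h (exp s) * ennreal (exp s) \<partial>lborel)"
  proof (rule nn_integral_LIMSEQ)
    show "(\<lambda>n. h (exp s) * ennreal (exp s) * indicator (?J n) s) \<longlonglongrightarrow> h (exp s) * ennreal (exp s)" for s
      by (rule tendsto_eventually, rule eventually_mono[OF ev[of s]]) (auto simp: abs_le_iff)
    have sub: "?J m \<subseteq> ?J n" if "m \<le> n" for m n using that by simp
    show "incseq (\<lambda>n s. h (exp s) * ennreal (exp s) * indicator (?J n) s)"
      unfolding incseq_def le_fun_def by (intro allI impI mult_left_mono ind sub) simp_all
  qed simp
  ultimately show ?thesis unfolding * by (rule LIMSEQ_unique)
qed

section \<open>Self-similar sets: dimension and upper bound for the volume\<close>

text \<open>Each application of \<open>step\<close> enlarges the arguments at least by the factor \<open>1 / q\<close>, and never beyond \<open>R\<close>, so that after finitely many steps they all lie in \<open>{1..R}\<close>.\<close>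

lemma bounded_by_scale_induction:
  fixes h p r :: "_ \<Rightarrow> real" and ii :: "'i set"
  assumes "finite ii" "(\<Sum>i\<in>ii. p i) = 1" "\<And>i. i \<in> ii \<Longrightarrow> 0 \<le> p i"
    and r: "\<And>i. i \<in> ii \<Longrightarrow> 0 < r i \<and> r i \<le> q \<and> 1 / r i \<le> R" and q: "0 < q" "q < 1"
    and base: "\<And>\<epsilon>. 1 \<le> \<epsilon> \<Longrightarrow> \<epsilon> \<le> R \<Longrightarrow> h \<epsilon> \<le> B"
    and step: "\<And>\<epsilon>. 0 < \<epsilon> \<Longrightarrow> \<epsilon> < 1 \<Longrightarrow> h \<epsilon> \<le> (\<Sum>i\<in>ii. p i * h (\<epsilon> / r i))"
    and \<epsilon>: "0 < \<epsilon>" "\<epsilon> \<le> R"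
  shows "h \<epsilon> \<le> B"
proof -
  have *: "h \<epsilon> \<le> B" if "q ^ n \<le> \<epsilon>" "\<epsilon> \<le> R" for n \<epsilon>
    using that
  proof (induction n arbitrary: \<epsilon>)
    case 0 then show ?case using base by simp
  next
    case (Suc n)
    show ?case
    proof (cases "1 \<le> \<epsilon>")
      case True then show ?thesis using base Suc.prems by simp
    next
      case False
      have e0: "\<epsilon> > 0" using Suc.prems q zero_less_power[OF q(1), of "Suc n"] by linarith
      have "h \<epsilon> \<le> (\<Sum>i\<in>ii. p i * h (\<epsilon> / r i))" using step e0 False by simp
      also have "\<dots> \<le> (\<Sum>i\<in>ii. p i * B)"
      proof (intro sum_mono mult_left_mono)
        fix i assume i: "i \<in> ii"
        note ri = r[OF i]
        have "q ^ n \<le> \<epsilon> / q" using Suc.prems q by (simp add: field_simps)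
        also have "\<dots> \<le> \<epsilon> / r i" using ri e0 by (intro divide_left_mono) auto
        finally have 1: "q ^ n \<le> \<epsilon> / r i" .
        have "\<epsilon> / r i \<le> 1 / r i" using ri False by (intro divide_right_mono) auto
        then have "\<epsilon> / r i \<le> R" using ri by linarith
        then show "h (\<epsilon> / r i) \<le> B" by (rule Suc.IH[OF 1])
      qed (use assms in auto)
      also have "\<dots> = B" using assms(2) by (simp add: sum_distrib_right[symmetric])
      finally show ?thesis .
    qed
  qed
  obtain n where "q ^ n < \<epsilon>" using real_arch_pow_inv[OF \<epsilon>(1) q(2)] by blast
  then show ?thesis using *[of n \<epsilon>] \<epsilon>(2) by simp
qed

locale self_similar_system =
  fixes N :: nat and S :: "nat \<Rightarrow> 'a::euclidean_space \<Rightarrow> 'a" and r :: "nat \<Rightarrow> real"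
    and F V :: "'a set" and D :: real
  assumes ifs: "similarity_ifs N S r"
    and F: "self_similar_set N S F"
    and D: "(\<Sum>i=1..N. r i powr D) = 1"
    and V: "strong_feasible_open_set N S F V"
begin

abbreviation "I \<equiv> {1..N}"

lemma I: "finite I" "I \<noteq> {}"
  using ifs by (auto simp: similarity_ifs_def)

lemma r: "i \<in> I \<Longrightarrow> 0 < r i" "i \<in> I \<Longrightarrow> r i < 1"
  using ifs by (auto simp: similarity_ifs_def)

lemma dist_S: "i \<in> I \<Longrightarrow> dist (S i x) (S i y) = r i * dist x y"
  using ifs by (auto simp: similarity_ifs_def)

lemma attractor: "F \<noteq> {}" "compact F" "bounded F" "closed F" "F = (\<Union>i\<in>I. S i ` F)"
  using F by (auto simp: self_similar_set_def ifs_image_def compact_imp_bounded compact_imp_closed)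

lemma feasible: "V \<noteq> {}" "bounded V" "open V" "V \<in> sets borel"
  "i \<in> I \<Longrightarrow> S i ` V \<subseteq> V" "disjoint_family_on (\<lambda>i. S i ` V) I" "V \<inter> F \<noteq> {}"
  using V by (auto simp: strong_feasible_open_set_def feasible_open_set_def)

lemma bij_S: "i \<in> I \<Longrightarrow> bij (S i)"
  using similarity_bij[OF r(1) dist_S] .

lemma open_SV: "i \<in> I \<Longrightarrow> open (S i ` V)"
  using similarity_open_image[OF r(1) dist_S] feasible(3) by blast

lemma borel_SV [measurable]: "i \<in> I \<Longrightarrow> S i ` V \<in> sets borel"
  using open_SV by (rule borel_open)

lemma S_compact:
  assumes "i \<in> I" "compact A" shows "compact (S i ` A)"
  by (rule similarity_compact_image[OF r(1)[OF assms(1)] dist_S[OF assms(1)] assms(2)])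

lemma pieces:
  assumes "i \<in> I"
  shows "bounded (S i ` F)" "S i ` F \<noteq> {}" "S i ` F \<subseteq> F" "closed (S i ` F)"
proof -
  show "bounded (S i ` F)" "S i ` F \<noteq> {}" "closed (S i ` F)"
    using S_compact[OF assms attractor(2)] attractor(1) by (auto intro: compact_imp_bounded compact_imp_closed)
  show "S i ` F \<subseteq> F" by (subst (2) attractor(5)) (use assms in blast)
qed

lemma ratio_bounds:
  obtains q R where "0 < q" "q < 1" "\<And>i. i \<in> I \<Longrightarrow> r i \<le> q" "1 \<le> R" "\<And>i. i \<in> I \<Longrightarrow> 1 / r i \<le> R"
proof
  have fin: "finite (r ` I)" "r ` I \<noteq> {}" using I by auto
  show "0 < Max (r ` I)" "Max (r ` I) < 1" using fin r I by (auto simp: Max_gr_iff)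
  show "r i \<le> Max (r ` I)" if "i \<in> I" for i using fin that by (auto intro: Max_ge)
  have fin': "finite ((\<lambda>i. 1 / r i) ` I)" using I by auto
  show le: "1 / r i \<le> Max ((\<lambda>i. 1 / r i) ` I)" if "i \<in> I" for i using fin' that by (intro Max_ge) auto
  obtain i where i: "i \<in> I" using I by auto
  have "1 \<le> 1 / r i" using r[OF i] by simp
  then show "1 \<le> Max ((\<lambda>i. 1 / r i) ` I)" using le[OF i] by linarith
qed

definition \<Gamma> :: "'a set" where "\<Gamma> = V - ifs_image N S V"

lemma borel_\<Gamma> [measurable]: "\<Gamma> \<in> sets borel"
proof -
  have "open (ifs_image N S V)" unfolding ifs_image_def using open_SV by (intro open_UN) auto
  then show ?thesis unfolding \<Gamma>_def using feasible by (intro sets.Diff) auto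
qed

lemma V_decomp: "V = \<Gamma> \<union> (\<Union>i\<in>I. S i ` V)" "\<Gamma> \<inter> (\<Union>i\<in>I. S i ` V) = {}"
proof -
  have "(\<Union>i\<in>I. S i ` V) \<subseteq> V" by (rule UN_least) (rule feasible(5))
  then show "V = \<Gamma> \<union> (\<Union>i\<in>I. S i ` V)" "\<Gamma> \<inter> (\<Union>i\<in>I. S i ` V) = {}"
    unfolding \<Gamma>_def ifs_image_def by blast+
qed

lemma V_measure: "V \<in> lmeasurable" "\<Gamma> \<in> lmeasurable" "0 < measure lebesgue V"
proof -
  show "V \<in> lmeasurable" using feasible by (auto intro: bounded_set_imp_lmeasurable)
  have "bounded \<Gamma>" using feasible(2) by (rule bounded_subset) (auto simp: \<Gamma>_def)
  then show "\<Gamma> \<in> lmeasurable" using borel_\<Gamma> by (intro bounded_set_imp_lmeasurable) auto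
  have "\<not> negligible V" using feasible by (intro open_not_negligible)
  then show "0 < measure lebesgue V"
    using \<open>V \<in> lmeasurable\<close> by (metis measure_nonneg negligible_iff_measure0 order_le_less)
qed

lemma measure_V: "measure lebesgue V = measure lebesgue \<Gamma> + (\<Sum>i\<in>I. r i ^ DIM('a)) * measure lebesgue V"
proof -
  have m: "measure lebesgue (S i ` V) = r i ^ DIM('a) * measure lebesgue V" "S i ` V \<in> lmeasurable" if "i \<in> I" for i
  proof -
    show "measure lebesgue (S i ` V) = r i ^ DIM('a) * measure lebesgue V"
      using that by (intro similarity_measure r dist_S feasible)
    have "bounded (S i ` V)" using feasible(2) feasible(5)[OF that] by (rule bounded_subset)
    then show "S i ` V \<in> lmeasurable" using open_SV[OF that] by (intro bounded_set_imp_lmeasurable) auto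
  qed
  have "measure lebesgue V = measure lebesgue (\<Gamma> \<union> (\<Union>i\<in>I. S i ` V))" using V_decomp by simp
  also have "\<dots> = measure lebesgue \<Gamma> + measure lebesgue (\<Union>i\<in>I. S i ` V)"
    using m V_measure V_decomp I by (intro measure_Un3[THEN trans]) (auto intro!: fmeasurable.finite_UN)
  also have "measure lebesgue (\<Union>i\<in>I. S i ` V) = (\<Sum>i\<in>I. measure lebesgue (S i ` V))"
    using I feasible(6) m(2) fmeasurableD2[OF m(2)]
    by (intro measure_finite_Union) (auto simp del: emeasure_completion intro: fmeasurableD)
  also have "\<dots> = (\<Sum>i\<in>I. r i ^ DIM('a)) * measure lebesgue V" using m(1) by (simp add: sum_distrib_right)
  finally show ?thesis .
qed

text \<open>The sets \<open>S i ` V\<close> are disjoint subsets of \<open>V\<close>, and \<open>V\<close> has positive finite volume.\<close>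

lemma sum_ratio_power_le_1: "(\<Sum>i\<in>I. r i ^ DIM('a)) \<le> 1"
proof -
  have "(\<Sum>i\<in>I. r i ^ DIM('a)) * measure lebesgue V \<le> 1 * measure lebesgue V" using measure_V measure_nonneg[of lebesgue \<Gamma>] by linarith
  then show ?thesis using V_measure(3) mult_right_le_imp_le by blast
qed

lemma D_le_d: "D \<le> real DIM('a)"
proof (rule ccontr)
  assume "\<not> D \<le> real DIM('a)"
  then have "(\<Sum>i\<in>I. r i powr D) < (\<Sum>i\<in>I. r i ^ DIM('a))"
    using I r by (intro sum_strict_mono) (auto simp: powr_realpow[symmetric] intro!: powr_less_mono')
  then show False using D sum_ratio_power_le_1 by simp
qed

lemma sum_ratio_power_lt_1: "D < real DIM('a) \<Longrightarrow> (\<Sum>i\<in>I. r i ^ DIM('a)) < 1"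
proof -
  assume "D < real DIM('a)"
  then have "(\<Sum>i\<in>I. r i ^ DIM('a)) < (\<Sum>i\<in>I. r i powr D)"
    using I r by (intro sum_strict_mono) (auto simp: powr_realpow[symmetric] intro!: powr_less_mono')
  then show ?thesis using D by simp
qed

text \<open>In the full-dimensional case the pieces of \<open>V\<close> use up its whole volume.\<close>

lemma measure_\<Gamma>_0: "D = real DIM('a) \<Longrightarrow> measure lebesgue \<Gamma> = 0"
proof -
  assume "D = real DIM('a)"
  then have "(\<Sum>i\<in>I. r i ^ DIM('a)) = 1" using D r by (simp add: powr_realpow)
  then show ?thesis using measure_V by simp
qed

text \<open>The exponent is the one for which a similarity of ratio \<open>c\<close> acts by the factor \<open>c powr D\<close> and a rescaling of \<open>\<epsilon>\<close>.\<close>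

definition scaled :: "'a set \<Rightarrow> 'a set \<Rightarrow> real \<Rightarrow> real" where
  "scaled A W \<epsilon> = \<epsilon> powr (D - real DIM('a)) * parallel_volume A W \<epsilon>"

lemma scaled_nonneg [simp]: "0 \<le> scaled A W \<epsilon>" by (simp add: scaled_def)

lemma scaled_mono:
  assumes "bounded A" "A \<noteq> {}" "W \<in> sets borel" "W' \<in> sets borel" "W \<subseteq> W'"
  shows "scaled A W \<epsilon> \<le> scaled A W' \<epsilon>"
  unfolding scaled_def using assms by (intro mult_left_mono parallel_volume_mono) auto

lemma scaled_similarity:
  fixes f :: "'a \<Rightarrow> 'a"
  assumes c: "c > 0" and f: "\<And>x y. dist (f x) (f y) = c * dist x y" and "W \<in> sets borel" and \<epsilon>: "0 < \<epsilon>"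
  shows "scaled (f ` A) (f ` W) \<epsilon> = c powr D * scaled A W (\<epsilon> / c)"
proof -
  have "\<epsilon> powr (D - real DIM('a)) * c ^ DIM('a) = c powr D * (\<epsilon> / c) powr (D - real DIM('a))"
    using c \<epsilon> by (simp add: powr_divide powr_diff powr_realpow)
  then show ?thesis unfolding scaled_def parallel_volume_similarity[OF c f assms(3)]
    by (metis mult.assoc)
qed

lemma scaled_UN_left:
  assumes "finite ii" "ii \<noteq> {}" "\<And>i. i \<in> ii \<Longrightarrow> compact (A i)" "\<And>i. i \<in> ii \<Longrightarrow> A i \<noteq> {}" "W \<in> sets borel"
  shows "scaled (\<Union>i\<in>ii. A i) W \<epsilon> \<le> (\<Sum>i\<in>ii. scaled (A i) W \<epsilon>)"
  unfolding scaled_def sum_distrib_left[symmetric]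
  by (intro mult_left_mono parallel_volume_UN_left assms) auto

lemma scaled_UNIV_bounded: "\<exists>B\<ge>0. \<forall>\<epsilon>. 0 < \<epsilon> \<and> \<epsilon> \<le> 1 \<longrightarrow> scaled F UNIV \<epsilon> \<le> B"
proof -
  obtain q R where qR: "0 < q" "q < 1" "\<And>i. i \<in> I \<Longrightarrow> r i \<le> q" "1 \<le> R" "\<And>i. i \<in> I \<Longrightarrow> 1 / r i \<le> R"
    by (rule ratio_bounds) blast
  define B where "B = parallel_volume F UNIV R"
  have "scaled F UNIV \<epsilon> \<le> B" if e: "0 < \<epsilon>" "\<epsilon> \<le> 1" for \<epsilon>
  proof (rule bounded_by_scale_induction[where h = "scaled F UNIV" and p = "\<lambda>i. r i powr D" and ii = I and r = r and q = q and R = R])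
    show "scaled F UNIV \<epsilon> \<le> B" if "1 \<le> \<epsilon>" "\<epsilon> \<le> R" for \<epsilon>
    proof -
      have "\<epsilon> powr (D - real DIM('a)) \<le> \<epsilon> powr 0" using that D_le_d by (intro powr_mono) auto
      then have "\<epsilon> powr (D - real DIM('a)) \<le> 1" using that by simp
      moreover have "parallel_volume F UNIV \<epsilon> \<le> B" unfolding B_def using attractor that
        by (intro parallel_volume_mono) auto
      ultimately show ?thesis unfolding scaled_def using mult_mono[of "\<epsilon> powr (D - real DIM('a))" 1 "parallel_volume F UNIV \<epsilon>" B] by simp
    qed
    show "scaled F UNIV \<epsilon> \<le> (\<Sum>i\<in>I. r i powr D * scaled F UNIV (\<epsilon> / r i))" if "0 < \<epsilon>" "\<epsilon> < 1" for \<epsilon>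
    proof -
      have "scaled F UNIV \<epsilon> \<le> (\<Sum>i\<in>I. scaled (S i ` F) UNIV \<epsilon>)"
        by (subst attractor(5), intro scaled_UN_left S_compact I attractor) (use attractor in auto)
      also have "\<dots> = (\<Sum>i\<in>I. r i powr D * scaled F UNIV (\<epsilon> / r i))"
      proof (rule sum.cong[OF refl])
        fix i assume i: "i \<in> I"
        have "S i ` UNIV = UNIV" using bij_S[OF i] by (simp add: bij_is_surj)
        then show "scaled (S i ` F) UNIV \<epsilon> = r i powr D * scaled F UNIV (\<epsilon> / r i)"
          using scaled_similarity[OF r(1)[OF i] dist_S[OF i], of UNIV \<epsilon> F] that by simp
      qed
      finally show ?thesis .
    qed
  qed (use e qR I D r in auto)
  then show ?thesis by (intro exI[of _ B]) (auto simp: B_def)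
qed

section \<open>The parallel volume outside the open set\<close>

text \<open>Points outside of \<open>V\<close> are images of points outside of \<open>V\<close>, because \<open>f\<close> is onto and maps \<open>V\<close> into itself.\<close>

lemma scaled_outside_similarity_le:
  fixes f :: "'a \<Rightarrow> 'a"
  assumes c: "c > 0" and f: "\<And>x y. dist (f x) (f y) = c * dist x y" and sub: "f ` V \<subseteq> V"
    and A: "bounded A" "A \<noteq> {}" "bounded (f ` A)" and \<epsilon>: "0 < \<epsilon>"
  shows "scaled (f ` A) (- V) \<epsilon> \<le> c powr D * scaled A (- V) (\<epsilon> / c)"
proof -
  have bV: "- V \<in> sets borel" using feasible by (intro borel_comp)
  have "f ` (- V) = - (f ` V)" by (rule bij_image_Compl_eq[OF similarity_bij[OF c f]])
  then have "- V \<subseteq> f ` (- V)" using sub by blast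
  then have "scaled (f ` A) (- V) \<epsilon> \<le> scaled (f ` A) (f ` (- V)) \<epsilon>"
    using A bV similarity_borel_image[OF c f bV] by (intro scaled_mono) auto
  also have "\<dots> = c powr D * scaled A (- V) (\<epsilon> / c)" by (rule scaled_similarity[OF c f bV \<epsilon>])
  finally show ?thesis .
qed

text \<open>Any bound \<open>B\<close> for the scaled volume outside of \<open>V\<close> on small scales also holds with \<open>B\<close> multiplied by \<open>1 - t powr D\<close>,
  up to the contribution of the copy \<open>T ` F\<close>: the other copies of \<open>F\<close> of comparable size have total weight
  \<open>1 - t powr D\<close>. With this notion the copies need not be indexed by words.\<close>

definition contraction_gain :: "('a \<Rightarrow> 'a) \<Rightarrow> real \<Rightarrow> bool" where
  "contraction_gain T t \<longleftrightarrow> (\<forall>B e0. 0 \<le> B \<longrightarrow> 0 < e0 \<longrightarrow> (\<forall>\<epsilon>. 0 < \<epsilon> \<and> \<epsilon> < e0 \<longrightarrow> scaled F (- V) \<epsilon> \<le> B) \<longrightarrow>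
     (\<exists>e1>0. \<forall>\<epsilon>. 0 < \<epsilon> \<and> \<epsilon> < e1 \<longrightarrow>
        scaled F (- V) \<epsilon> \<le> scaled (T ` F) (- V) \<epsilon> + (1 - t powr D) * B))"

text \<open>Splitting the copy \<open>T ` F\<close> into its pieces keeps one of them and estimates each of the others by self-similarity and the bound \<open>B\<close>.\<close>

lemma contraction_gain_compose:
  assumes t: "t > 0" and T: "\<And>x y. dist (T x) (T y) = t * dist x y" and sub: "T ` V \<subseteq> V"
    and gain: "contraction_gain T t" and j: "j \<in> I"
  shows "contraction_gain (T \<circ> S j) (t * r j)"
  unfolding contraction_gain_def
proof (intro allI impI)
  fix B e0 :: real
  assume B: "0 \<le> B" and e0: "0 < e0" and bd: "\<forall>\<epsilon>. 0 < \<epsilon> \<and> \<epsilon> < e0 \<longrightarrow> scaled F (- V) \<epsilon> \<le> B"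
  obtain e1 where e1: "e1 > 0" "\<And>\<epsilon>. 0 < \<epsilon> \<Longrightarrow> \<epsilon> < e1 \<Longrightarrow>
        scaled F (- V) \<epsilon> \<le> scaled (T ` F) (- V) \<epsilon> + (1 - t powr D) * B"
    using gain[unfolded contraction_gain_def, rule_format, OF B e0] bd by auto
  obtain R where R: "1 \<le> R" "\<And>i. i \<in> I \<Longrightarrow> 1 / r i \<le> R" by (rule ratio_bounds) blast
  \<comment> \<open>For \<open>\<epsilon>\<close> below the second bound, \<open>\<epsilon> / (t * r i)\<close> is below \<open>e0\<close> for every \<open>i\<close>.\<close>
  define e2 where "e2 = min e1 (e0 * t / R)"
  have e2: "e2 > 0" using e1 e0 t R by (simp add: e2_def)
  have bV: "- V \<in> sets borel" using feasible by (intro borel_comp)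
  have TS: "dist ((T \<circ> S i) x) ((T \<circ> S i) y) = (t * r i) * dist x y" if "i \<in> I" for i x y
    using T dist_S[OF that] by simp
  have cont: "compact ((T \<circ> S i) ` F)" if "i \<in> I" for i
    using t r[OF that] by (intro similarity_compact_image[OF _ TS[OF that] attractor(2)]) simp
  have "scaled F (- V) \<epsilon> \<le> scaled ((T \<circ> S j) ` F) (- V) \<epsilon> + (1 - (t * r j) powr D) * B"
    if \<epsilon>: "0 < \<epsilon>" "\<epsilon> < e2" for \<epsilon>
  proof -
    have small: "scaled ((T \<circ> S i) ` F) (- V) \<epsilon> \<le> (t powr D * B) * r i powr D" if i: "i \<in> I" for i
    proof -
      have c: "t * r i > 0" using t r[OF i] by simp
      have "(T \<circ> S i) ` V \<subseteq> V" using sub feasible(5)[OF i] by (auto simp: image_comp[symmetric])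
      then have "scaled ((T \<circ> S i) ` F) (- V) \<epsilon> \<le> (t * r i) powr D * scaled F (- V) (\<epsilon> / (t * r i))"
        by (intro scaled_outside_similarity_le c TS i attractor compact_imp_bounded cont \<epsilon>)
      also have "\<dots> \<le> (t * r i) powr D * B"
      proof (intro mult_left_mono bd[rule_format] conjI)
        show "0 < \<epsilon> / (t * r i)" using \<epsilon> c by simp
        have "\<epsilon> / (t * r i) = (\<epsilon> / t) * (1 / r i)" by simp
        also have "\<dots> \<le> (\<epsilon> / t) * R" using R(2)[OF i] \<epsilon> t by (intro mult_left_mono) auto
        also have "\<dots> < e0"
        proof -
          have "\<epsilon> < e0 * t / R" using \<epsilon> by (simp add: e2_def)
          then show ?thesis using t R by (simp add: field_simps)
        qed
        finally show "\<epsilon> / (t * r i) < e0" .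
      qed auto
      also have "\<dots> = (t powr D * B) * r i powr D" using t r[OF i] by (simp add: powr_mult)
      finally show ?thesis .
    qed
    have "T ` F = T ` (\<Union>i\<in>I. S i ` F)" using attractor(5) by simp
    also have "\<dots> = (\<Union>i\<in>I. (T \<circ> S i) ` F)" unfolding image_UN image_comp ..
    finally have "T ` F = (\<Union>i\<in>I. (T \<circ> S i) ` F)" .
    then have "scaled (T ` F) (- V) \<epsilon> \<le> (\<Sum>i\<in>I. scaled ((T \<circ> S i) ` F) (- V) \<epsilon>)"
      using scaled_UN_left[of I "\<lambda>i. (T \<circ> S i) ` F" "- V" \<epsilon>] I cont attractor(1) bV by simp
    also have "\<dots> = scaled ((T \<circ> S j) ` F) (- V) \<epsilon> + (\<Sum>i\<in>I - {j}. scaled ((T \<circ> S i) ` F) (- V) \<epsilon>)"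
      by (rule sum.remove[OF I(1) j])
    also have "(\<Sum>i\<in>I - {j}. scaled ((T \<circ> S i) ` F) (- V) \<epsilon>) \<le> (\<Sum>i\<in>I - {j}. (t powr D * B) * r i powr D)"
      by (intro sum_mono small) auto
    also have "\<dots> = (t powr D * B) * (1 - r j powr D)"
      unfolding sum_distrib_left[symmetric] using sum.remove[OF I(1) j, of "\<lambda>i. r i powr D"] D by simp
    finally have "scaled (T ` F) (- V) \<epsilon> \<le> scaled ((T \<circ> S j) ` F) (- V) \<epsilon> + (t powr D * B) * (1 - r j powr D)"
      by simp
    moreover have "scaled F (- V) \<epsilon> \<le> scaled (T ` F) (- V) \<epsilon> + (1 - t powr D) * B"
      using e1(2) \<epsilon> by (simp add: e2_def)
    moreover have "(1 - t powr D) * B + (t powr D * B) * (1 - r j powr D) = (1 - (t * r j) powr D) * B"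
      using t r[OF j] by (simp add: powr_mult algebra_simps)
    ultimately show ?thesis by linarith
  qed
  then show "\<exists>e1>0. \<forall>\<epsilon>. 0 < \<epsilon> \<and> \<epsilon> < e1 \<longrightarrow>
        scaled F (- V) \<epsilon> \<le> scaled ((T \<circ> S j) ` F) (- V) \<epsilon> + (1 - (t * r j) powr D) * B"
    using e2 by blast
qed

text \<open>Following the pieces that contain \<open>x\<close> leads to arbitrarily small copies of \<open>F\<close> at \<open>x\<close>.\<close>

lemma small_copy_at_point:
  assumes x: "x \<in> F" and q: "0 < q" "\<And>i. i \<in> I \<Longrightarrow> r i \<le> q"
  shows "\<exists>T t. 0 < t \<and> t \<le> q ^ n \<and> (\<forall>x y. dist (T x) (T y) = t * dist x y) \<and> T ` V \<subseteq> V
           \<and> x \<in> T ` F \<and> contraction_gain T t"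
proof (induction n)
  case 0
  show ?case by (rule exI[of _ id], rule exI[of _ 1]) (use x in \<open>auto simp: contraction_gain_def\<close>)
next
  case (Suc n)
  then obtain T t where T: "0 < t" "t \<le> q ^ n" "\<And>x y. dist (T x) (T y) = t * dist x y" "T ` V \<subseteq> V"
     "x \<in> T ` F" "contraction_gain T t" by blast
  then obtain y where y: "y \<in> F" "x = T y" by blast
  then obtain j where j: "j \<in> I" "y \<in> S j ` F" using attractor(5) by blast
  show ?case
  proof (rule exI[of _ "T \<circ> S j"], rule exI[of _ "t * r j"], intro conjI allI)
    show "0 < t * r j" using T r[OF j(1)] by simp
    have "t * r j \<le> q ^ n * q" using T r[OF j(1)] q j by (intro mult_mono) auto
    then show "t * r j \<le> q ^ Suc n" by (simp add: mult.commute)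
    show "dist ((T \<circ> S j) a) ((T \<circ> S j) b) = t * r j * dist a b" for a b using T(3) dist_S[OF j(1)] by simp
    show "(T \<circ> S j) ` V \<subseteq> V" using T(4) feasible(5)[OF j(1)] by (auto simp: image_comp[symmetric])
    show "x \<in> (T \<circ> S j) ` F" using y j by (auto simp: image_comp[symmetric])
    show "contraction_gain (T \<circ> S j) (t * r j)" by (rule contraction_gain_compose[OF T(1,3,4,6) j(1)])
  qed
qed

text \<open>At a point of \<open>F\<close> in \<open>V\<close> there is a copy \<open>T ` F\<close> so small that its parallel sets stay in \<open>V\<close> for a
  while. By the contraction gain of \<open>T\<close>, an eventual bound \<open>B\<close> then improves to \<open>(1 - t powr D) * B\<close>, and this
  can be iterated.\<close>

lemma scaled_outside_tendsto_0: "(scaled F (- V) \<longlongrightarrow> 0) (at_right 0)"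
proof -
  let ?u = "scaled F (- V)"
  have bV: "- V \<in> sets borel" using feasible by (intro borel_comp)
  obtain q R where q: "0 < q" "q < 1" "\<And>i. i \<in> I \<Longrightarrow> r i \<le> q"
    by (rule ratio_bounds) blast
  obtain x where x: "x \<in> F" "x \<in> V" using feasible by blast
  obtain \<rho> where \<rho>: "\<rho> > 0" "ball x \<rho> \<subseteq> V" using x feasible(3) openE by blast
  \<comment> \<open>One is added to have a positive number even if \<open>F\<close> is a single point.\<close>
  define \<Delta> where "\<Delta> = diameter F + 1"
  have \<Delta>: "\<Delta> > 0" using diameter_ge_0[OF attractor(3)] by (simp add: \<Delta>_def)
  obtain n where n: "q ^ n < \<rho> / (2 * \<Delta>)" using real_arch_pow_inv[of "\<rho> / (2 * \<Delta>)" q] \<rho> \<Delta> q by auto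
  obtain T t where T: "0 < t" "t \<le> q ^ n" "\<And>x y. dist (T x) (T y) = t * dist x y" "T ` V \<subseteq> V"
     "x \<in> T ` F" "contraction_gain T t" using small_copy_at_point[OF x(1) q(1,3), where n = n] by blast
  have zero: "scaled (T ` F) (- V) \<epsilon> = 0" if \<epsilon>: "0 < \<epsilon>" "\<epsilon> < \<rho> / 2" for \<epsilon>
  proof -
    have "z \<in> V" if z: "z \<in> parallel_set (T ` F) \<epsilon>" for z
    proof -
      have "compact (T ` F)" by (rule similarity_compact_image[OF T(1,3) attractor(2)])
      then obtain y where y: "y \<in> T ` F" "infdist z (T ` F) = dist z y"
        using infdist_attains_inf[of "T ` F" z] attractor(1) by (auto dest: compact_imp_closed)
      obtain a b where ab: "a \<in> F" "b \<in> F" "x = T a" "y = T b" using y T(5) by blast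
      have "dist x y = t * dist a b" using ab T(3) by simp
      also have "\<dots> \<le> q ^ n * \<Delta>"
        using T(1,2) diameter_bounded_bound[OF attractor(3) ab(1,2)] by (intro mult_mono) (auto simp: \<Delta>_def)
      also have "\<dots> < \<rho> / 2" using n \<Delta> by (simp add: field_simps)
      finally have "dist x z < \<rho>"
        using dist_triangle[of x z y] y z \<epsilon> by (simp add: parallel_set_def dist_commute)
      then show ?thesis using \<rho> by auto
    qed
    then have "parallel_set (T ` F) \<epsilon> \<inter> - V = {}" by blast
    then show ?thesis by (simp add: scaled_def parallel_volume_def)
  qed
  define \<kappa> where "\<kappa> = 1 - t powr D"
  obtain B where B: "0 \<le> B" "\<And>\<epsilon>. 0 < \<epsilon> \<Longrightarrow> \<epsilon> \<le> 1 \<Longrightarrow> ?u \<epsilon> \<le> B"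
  proof -
    obtain B where "0 \<le> B" "\<And>\<epsilon>. 0 < \<epsilon> \<Longrightarrow> \<epsilon> \<le> 1 \<Longrightarrow> scaled F UNIV \<epsilon> \<le> B" using scaled_UNIV_bounded by blast
    moreover have "?u \<epsilon> \<le> scaled F UNIV \<epsilon>" for \<epsilon> using attractor bV by (intro scaled_mono) auto
    ultimately show ?thesis using that order_trans by metis
  qed
  have \<kappa>1: "\<kappa> < 1" using T(1) by (simp add: \<kappa>_def)
  \<comment> \<open>A nonnegative factor keeps its powers nonnegative, as the iteration of the bound requires.\<close>
  define \<kappa>' where "\<kappa>' = max \<kappa> 0"
  have \<kappa>': "0 \<le> \<kappa>'" "\<kappa>' < 1" using \<kappa>1 by (auto simp: \<kappa>'_def)
  have iter: "\<exists>e>0. \<forall>\<epsilon>. 0 < \<epsilon> \<and> \<epsilon> < e \<longrightarrow> ?u \<epsilon> \<le> \<kappa>' ^ m * B" for m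
  proof (induction m)
    case 0 show ?case by (rule exI[of _ 1]) (use B in auto)
  next
    case (Suc m)
    then obtain e where e: "e > 0" "\<forall>\<epsilon>. 0 < \<epsilon> \<and> \<epsilon> < e \<longrightarrow> ?u \<epsilon> \<le> \<kappa>' ^ m * B" by blast
    have B': "0 \<le> \<kappa>' ^ m * B" using \<kappa>' B by simp
    obtain e1 where e1: "e1 > 0" "\<And>\<epsilon>. 0 < \<epsilon> \<Longrightarrow> \<epsilon> < e1 \<Longrightarrow> ?u \<epsilon> \<le> scaled (T ` F) (- V) \<epsilon> + \<kappa> * (\<kappa>' ^ m * B)"
      using T(6)[unfolded contraction_gain_def, rule_format, OF B' e(1)] e(2) unfolding \<kappa>_def by blast
    have "?u \<epsilon> \<le> \<kappa>' ^ Suc m * B" if "0 < \<epsilon>" "\<epsilon> < min e1 (\<rho> / 2)" for \<epsilon>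
    proof -
      have "?u \<epsilon> \<le> \<kappa> * (\<kappa>' ^ m * B)" using e1(2)[of \<epsilon>] zero[of \<epsilon>] that by simp
      also have "\<dots> \<le> \<kappa>' * (\<kappa>' ^ m * B)" using B' by (intro mult_right_mono) (auto simp: \<kappa>'_def)
      finally show ?thesis by (simp add: mult.assoc)
    qed
    then show ?case using e1(1) \<rho>(1) by (intro exI[of _ "min e1 (\<rho> / 2)"]) auto
  qed
  show ?thesis
  proof (rule tendstoI)
    fix e :: real assume e: "e > 0"
    obtain m where m: "\<kappa>' ^ m < e / (B + 1)" using real_arch_pow_inv[of "e / (B + 1)" \<kappa>'] e B \<kappa>' by auto
    obtain e1 where e1: "e1 > 0" "\<And>\<epsilon>. 0 < \<epsilon> \<Longrightarrow> \<epsilon> < e1 \<Longrightarrow> ?u \<epsilon> \<le> \<kappa>' ^ m * B" using iter[of m] by blast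
    have "\<kappa>' ^ m * B \<le> \<kappa>' ^ m * (B + 1)" using \<kappa>' by (intro mult_left_mono) auto
    also have "\<dots> < e" using m B by (simp add: field_simps)
    finally have lt: "\<kappa>' ^ m * B < e" .
    show "\<forall>\<^sub>F \<epsilon> in at_right 0. dist (?u \<epsilon>) 0 < e"
      unfolding eventually_at_right_field
      by (rule exI[of _ e1]) (use e1 lt in \<open>auto intro: le_less_trans\<close>)
  qed
qed

lemma has_minkowski_content_iff:
  assumes "W \<in> sets borel"
  shows "has_minkowski_content D F W m \<longleftrightarrow> ((\<lambda>\<epsilon>. ennreal (scaled F W \<epsilon>)) \<longlongrightarrow> m) (at_right 0)"
  unfolding has_minkowski_content_def scaled_def
  by (simp add: emeasure_parallel_set[OF attractor(3,1) assms] ennreal_mult)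

lemma scaled_exp_measurable:
  assumes "W \<in> sets borel"
  shows "(\<lambda>s. scaled F W (exp s)) \<in> borel_measurable borel" "scaled F W \<in> borel_measurable borel"
  using parallel_volume_measurable[OF attractor(3,1) assms] unfolding scaled_def by measurable

lemma scaled_exp_integrable:
  assumes W: "W \<in> sets borel"
  shows "(\<lambda>s. scaled F W (exp s)) integrable_on {a..b}"
proof (rule bounded_borel_integrable_on[OF scaled_exp_measurable(1)[OF W]])
  fix s assume s: "s \<in> {a..b}"
  have "exp s powr (D - real DIM('a)) \<le> exp a powr (D - real DIM('a))"
    using s D_le_d by (intro powr_mono2') auto
  moreover have "parallel_volume F W (exp s) \<le> parallel_volume F W (exp b)"
    using s W attractor by (intro parallel_volume_mono) auto
  ultimately show "\<bar>scaled F W (exp s)\<bar> \<le> exp a powr (D - real DIM('a)) * parallel_volume F W (exp b)"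
    by (simp add: scaled_def mult_mono)
qed

text \<open>The mean over \<open>{exp (- T)..1}\<close> with respect to the measure with density \<open>1 / \<epsilon>\<close>, in the logarithmic variable.\<close>

definition log_average :: "'a set \<Rightarrow> real \<Rightarrow> real" where
  "log_average W T = 1 / T * integral {-T..0} (\<lambda>s. scaled F W (exp s))"

lemma set_nn_integral_scaled:
  assumes W: "W \<in> sets borel" and T: "T > 0"
  shows "(\<integral>\<^sup>+\<epsilon>\<in>{exp (-T)..1}. ennreal (\<epsilon> powr (D - real DIM('a))) *
            emeasure lebesgue (parallel_set F \<epsilon> \<inter> W) * ennreal (1 / \<epsilon>) \<partial>lborel)
       = ennreal (integral {-T..0} (\<lambda>s. scaled F W (exp s)))"
proof -
  let ?h = "\<lambda>\<epsilon>. ennreal (scaled F W \<epsilon> * (1 / \<epsilon>)) * indicator {exp (-T)..1} \<epsilon>"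
  note [measurable] = scaled_exp_measurable(2)[OF W]
  have "(\<integral>\<^sup>+\<epsilon>\<in>{exp (-T)..1}. ennreal (\<epsilon> powr (D - real DIM('a))) *
            emeasure lebesgue (parallel_set F \<epsilon> \<inter> W) * ennreal (1 / \<epsilon>) \<partial>lborel)
      = (\<integral>\<^sup>+\<epsilon>\<in>{0<..}. ?h \<epsilon> \<partial>lborel)"
  proof (intro nn_integral_cong)
    fix \<epsilon> :: real
    show "ennreal (\<epsilon> powr (D - real DIM('a))) * emeasure lebesgue (parallel_set F \<epsilon> \<inter> W) * ennreal (1 / \<epsilon>)
        * indicator {exp (-T)..1} \<epsilon> = ?h \<epsilon> * indicator {0<..} \<epsilon>"
    proof (cases "\<epsilon> \<in> {exp (-T)..1}")
      case True
      then have "\<epsilon> > 0" using exp_gt_zero[of "-T"] by (auto simp del: exp_gt_zero)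
      then show ?thesis using True
        unfolding emeasure_parallel_set[OF attractor(3,1) W] scaled_def by (simp add: ennreal_mult[symmetric])
    qed simp
  qed
  also have "\<dots> = (\<integral>\<^sup>+s. ?h (exp s) * ennreal (exp s) \<partial>lborel)"
    by (rule nn_integral_exp_substitution) measurable
  also have "\<dots> = (\<integral>\<^sup>+s. ennreal (indicator {-T..0} s * scaled F W (exp s)) \<partial>lborel)"
  proof (intro nn_integral_cong)
    fix s :: real
    show "?h (exp s) * ennreal (exp s) = ennreal (indicator {-T..0} s * scaled F W (exp s))"
      by (auto simp: indicator_def ennreal_mult[symmetric])
  qed
  also have "\<dots> = ennreal (integral {-T..0} (\<lambda>s. scaled F W (exp s)))"
    by (rule nn_integral_has_integral_lebesgue) (auto intro!: integrable_integral scaled_exp_integrable W)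
  finally show ?thesis .
qed

text \<open>This is the substitution \<open>\<epsilon> = exp s\<close>, \<open>\<delta> = exp (- T)\<close> in the definition of the average content.\<close>

lemma has_average_minkowski_content_iff:
  assumes W: "W \<in> sets borel"
  shows "has_average_minkowski_content D F W m \<longleftrightarrow> ((\<lambda>T. ennreal (log_average W T)) \<longlongrightarrow> m) at_top"
proof -
  let ?G = "\<lambda>\<delta>. ennreal (1 / \<bar>ln \<delta>\<bar>) *
        (\<integral>\<^sup>+\<epsilon>\<in>{\<delta>..1}. ennreal (\<epsilon> powr (D - real DIM('a))) *
            emeasure lebesgue (parallel_set F \<epsilon> \<inter> W) * ennreal (1 / \<epsilon>) \<partial>lborel)"
  have eq: "?G (exp (- T)) = ennreal (log_average W T)" if T: "T > 0" for T
  proof -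
    have "0 \<le> integral {-T..0} (\<lambda>s. scaled F W (exp s))"
      using scaled_exp_integrable[OF W] by (intro Henstock_Kurzweil_Integration.integral_nonneg) auto
    then show ?thesis unfolding set_nn_integral_scaled[OF W T] log_average_def
      using T by (subst ennreal_mult) auto
  qed
  have "((\<lambda>T::real. exp (- T)) \<longlongrightarrow> 0) at_top"
    by (rule filterlim_compose[OF exp_at_bot filterlim_uminus_at_bot_at_top])
  then have lim1: "filterlim (\<lambda>T::real. exp (- T)) (at_right 0) at_top"
    by (rule tendsto_imp_filterlim_at_right) simp
  have lim2: "filterlim (\<lambda>\<delta>. - ln \<delta>) at_top (at_right (0::real))"
    using ln_at_0 by (simp add: filterlim_uminus_at_bot)
  show ?thesis unfolding has_average_minkowski_content_def
  proof
    assume "(?G \<longlongrightarrow> m) (at_right 0)"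
    then have "((\<lambda>T. ?G (exp (- T))) \<longlongrightarrow> m) at_top" by (rule filterlim_compose[OF _ lim1])
    then show "((\<lambda>T. ennreal (log_average W T)) \<longlongrightarrow> m) at_top"
      by (rule Lim_transform_eventually) (use eventually_gt_at_top[of 0] in \<open>rule eventually_mono, simp only: eq\<close>)
  next
    assume "((\<lambda>T. ennreal (log_average W T)) \<longlongrightarrow> m) at_top"
    then have *: "((\<lambda>\<delta>. ennreal (log_average W (- ln \<delta>))) \<longlongrightarrow> m) (at_right 0)" by (rule filterlim_compose[OF _ lim2])
    have "\<forall>\<^sub>F \<delta> in at_right 0. ennreal (log_average W (- ln \<delta>)) = ?G \<delta>"
      unfolding eventually_at_right_field
    proof (intro exI[of _ 1] conjI allI impI)
      fix \<delta> :: real assume "0 < \<delta>" "\<delta> < 1"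
      then have "- ln \<delta> > 0" "exp (- (- ln \<delta>)) = \<delta>" by auto
      then show "ennreal (log_average W (- ln \<delta>)) = ?G \<delta>" using eq[of "- ln \<delta>"] by simp
    qed simp
    then show "(?G \<longlongrightarrow> m) (at_right 0)" by (rule Lim_transform_eventually[OF *])
  qed
qed

section \<open>The renewal equation inside the open set\<close>

lemma borel_outside: "- V \<in> sets borel" using feasible by (intro borel_comp)

lemma scaled_split: "scaled F UNIV \<epsilon> = scaled F V \<epsilon> + scaled F (- V) \<epsilon>"
  using parallel_volume_Un[OF attractor(3,1) feasible(4) borel_outside, of \<epsilon>]
  by (simp add: scaled_def distrib_left)

lemma log_average_split: "log_average UNIV T = log_average V T + log_average (- V) T"
  unfolding log_average_def scaled_split
  by (subst Henstock_Kurzweil_Integration.integral_add)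
     (auto simp: distrib_left intro: scaled_exp_integrable feasible borel_outside)

lemma filterlim_exp_at_bot_at_right: "filterlim (exp :: real \<Rightarrow> real) (at_right 0) at_bot"
  by (rule tendsto_imp_filterlim_at_right[OF exp_at_bot]) simp

lemma log_average_tendsto:
  assumes W: "W \<in> sets borel" and lim: "(scaled F W \<longlongrightarrow> L) (at_right 0)"
  shows "(log_average W \<longlongrightarrow> L) at_top"
  unfolding log_average_def
  by (rule cesaro_mean_at_bot[OF scaled_exp_integrable[OF W] filterlim_compose[OF lim filterlim_exp_at_bot_at_right]])

text \<open>The contribution in \<open>S i ` V\<close> of those points that are close to \<open>F\<close> without being close to \<open>S i ` F\<close>; the second volume is at most the first.\<close>

definition excess :: "nat \<Rightarrow> real \<Rightarrow> real" where
  "excess i \<epsilon> = \<epsilon> powr (D - real DIM('a)) *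
     (parallel_volume F (S i ` V) \<epsilon> - parallel_volume (S i ` F) (S i ` V) \<epsilon>)"

lemma parallel_set_piece_subset:
  assumes "i \<in> I" shows "parallel_set (S i ` F) \<epsilon> \<subseteq> parallel_set F \<epsilon>"
  using infdist_mono[OF pieces(3,2)[OF assms]] order_trans unfolding parallel_set_def by blast

lemma excess_eq:
  assumes i: "i \<in> I"
  shows "excess i \<epsilon> = \<epsilon> powr (D - real DIM('a)) *
     measure lebesgue ((parallel_set F \<epsilon> - parallel_set (S i ` F) \<epsilon>) \<inter> S i ` V)"
proof -
  let ?P = "parallel_set F \<epsilon> \<inter> S i ` V" and ?Q = "parallel_set (S i ` F) \<epsilon> \<inter> S i ` V"
  have m: "?P \<in> lmeasurable" "?Q \<in> lmeasurable"
    using lmeasurable_parallel_set_Int attractor pieces[OF i] borel_SV[OF i] by blast+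
  have "?Q \<subseteq> ?P" using parallel_set_piece_subset[OF i] by blast
  then have "measure lebesgue (?P - ?Q) = measure lebesgue ?P - measure lebesgue ?Q"
    using m by (intro measurable_measure_Diff) (auto intro: fmeasurableD)
  moreover have "(parallel_set F \<epsilon> - parallel_set (S i ` F) \<epsilon>) \<inter> S i ` V = ?P - ?Q" by blast
  ultimately show ?thesis by (simp add: excess_def parallel_volume_def)
qed

lemma excess_nonneg: "i \<in> I \<Longrightarrow> 0 \<le> excess i \<epsilon>"
  by (simp add: excess_eq)

text \<open>In \<open>S i ` V\<close> the volume splits into that of the parallel set of \<open>S i ` F\<close>, which is a scaled copy of
  the volume in \<open>V\<close>, and the excess.\<close>

lemma renewal_equation:
  assumes \<epsilon>: "0 < \<epsilon>"
  shows "scaled F V \<epsilon> = (\<Sum>i\<in>I. r i powr D * scaled F V (\<epsilon> / r i)) + (scaled F \<Gamma> \<epsilon> + (\<Sum>i\<in>I. excess i \<epsilon>))"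
proof -
  have U: "(\<Union>i\<in>I. S i ` V) \<in> sets borel" using borel_SV by (intro sets.finite_UN) auto
  have "parallel_volume F V \<epsilon> = parallel_volume F \<Gamma> \<epsilon> + parallel_volume F (\<Union>i\<in>I. S i ` V) \<epsilon>"
    using parallel_volume_Un[OF attractor(3,1) borel_\<Gamma> U V_decomp(2), of \<epsilon>] V_decomp(1) by simp
  also have "parallel_volume F (\<Union>i\<in>I. S i ` V) \<epsilon> = (\<Sum>i\<in>I. parallel_volume F (S i ` V) \<epsilon>)"
    by (rule parallel_volume_UN[OF attractor(3,1) I(1) borel_SV feasible(6)])
  finally have "scaled F V \<epsilon> = scaled F \<Gamma> \<epsilon> + (\<Sum>i\<in>I. scaled F (S i ` V) \<epsilon>)"
    by (simp add: scaled_def distrib_left sum_distrib_left)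
  also have "(\<Sum>i\<in>I. scaled F (S i ` V) \<epsilon>) = (\<Sum>i\<in>I. r i powr D * scaled F V (\<epsilon> / r i) + excess i \<epsilon>)"
  proof (rule sum.cong[OF refl])
    fix i assume i: "i \<in> I"
    have "scaled (S i ` F) (S i ` V) \<epsilon> = r i powr D * scaled F V (\<epsilon> / r i)"
      by (rule scaled_similarity[OF r(1)[OF i] dist_S[OF i] feasible(4) \<epsilon>])
    then show "scaled F (S i ` V) \<epsilon> = r i powr D * scaled F V (\<epsilon> / r i) + excess i \<epsilon>"
      by (simp add: scaled_def excess_def right_diff_distrib)
  qed
  finally show ?thesis by (simp add: sum.distrib)
qed

definition scaled_V_limit :: real where
  "scaled_V_limit = (if D < real DIM('a) then 0 else measure lebesgue V)"

text \<open>For large \<open>\<epsilon>\<close> the parallel set contains \<open>V\<close>.\<close>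

lemma scaled_tendsto_at_top: "((\<lambda>s. scaled F V (exp s)) \<longlongrightarrow> scaled_V_limit) at_top"
proof -
  obtain x where x: "x \<in> F" using attractor by blast
  obtain R where R: "\<And>y. y \<in> V \<Longrightarrow> dist y x \<le> R"
    using feasible(2) bounded_any_center[of V x] by (auto simp: dist_commute)
  have eq: "scaled F V (exp s) = exp s powr (D - real DIM('a)) * measure lebesgue V" if "exp s \<ge> R" for s
  proof -
    have "V \<subseteq> parallel_set F (exp s)"
      using infdist_le[OF x] R that by (force simp: parallel_set_def intro: order_trans)
    then have "parallel_set F (exp s) \<inter> V = V" by blast
    then show ?thesis by (simp add: scaled_def parallel_volume_def)
  qed
  have ev: "\<forall>\<^sub>F s in at_top. exp s \<ge> R"
    using exp_at_top unfolding filterlim_at_top by blast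
  have "((\<lambda>s. exp s powr (D - real DIM('a)) * measure lebesgue V) \<longlongrightarrow> scaled_V_limit) at_top"
  proof (cases "D < real DIM('a)")
    case True
    have "((\<lambda>s::real. exp s powr (D - real DIM('a))) \<longlongrightarrow> 0) at_top"
      by (rule tendsto_neg_powr[OF _ exp_at_top]) (use True in simp)
    from tendsto_mult_right[OF this, of "measure lebesgue V"] show ?thesis using True by (simp add: scaled_V_limit_def)
  next
    case False
    then have "D - real DIM('a) = 0" using D_le_d by simp
    then have "exp s powr (D - real DIM('a)) = 1" for s :: real by simp
    then show ?thesis using False by (simp add: scaled_V_limit_def)
  qed
  then show ?thesis
    by (rule Lim_transform_eventually) (use ev in \<open>rule eventually_mono, simp only: eq\<close>)
qed

definition \<eta> :: real where "\<eta> = - (\<Sum>i\<in>I. r i powr D * ln (r i))"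

lemma \<eta>_pos: "\<eta> > 0"
proof -
  have "0 < (\<Sum>i\<in>I. r i powr D * (- ln (r i)))"
  proof (intro sum_pos I)
    fix i assume "i \<in> I"
    then show "0 < r i powr D * (- ln (r i))" using r[of i] by (intro mult_pos_pos) auto
  qed
  then show ?thesis by (simp add: \<eta>_def sum_negf)
qed

lemma scaled_V_bounded: "\<exists>M. \<forall>\<epsilon>>0. scaled F V \<epsilon> \<le> M"
proof -
  obtain B where B: "0 \<le> B" "\<And>\<epsilon>. 0 < \<epsilon> \<Longrightarrow> \<epsilon> \<le> 1 \<Longrightarrow> scaled F UNIV \<epsilon> \<le> B" using scaled_UNIV_bounded by blast
  have "scaled F V \<epsilon> \<le> B + measure lebesgue V" if e: "\<epsilon> > 0" for \<epsilon>
  proof (cases "\<epsilon> \<le> 1")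
    case True
    have "scaled F V \<epsilon> \<le> scaled F UNIV \<epsilon>" using attractor feasible(4) by (intro scaled_mono) auto
    then show ?thesis using B(2)[OF e True] measure_nonneg[of lebesgue V] by linarith
  next
    case False
    have "\<epsilon> powr (D - real DIM('a)) \<le> \<epsilon> powr 0" using False D_le_d by (intro powr_mono) auto
    then have "\<epsilon> powr (D - real DIM('a)) \<le> 1" using e by simp
    moreover have "parallel_volume F V \<epsilon> \<le> measure lebesgue V"
      unfolding parallel_volume_def
      using V_measure(1) fmeasurableD[OF lmeasurable_parallel_set_Int[OF attractor(3,1) feasible(4)]]
      by (intro measure_mono_fmeasurable) auto
    ultimately have "scaled F V \<epsilon> \<le> 1 * measure lebesgue V" unfolding scaled_def by (intro mult_mono) auto
    then show ?thesis using B(1) by simp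
  qed
  then show ?thesis by blast
qed

lemma excess_measurable: "i \<in> I \<Longrightarrow> (\<lambda>s. excess i (exp s)) \<in> borel_measurable borel"
  using parallel_volume_measurable[OF attractor(3,1) borel_SV]
    parallel_volume_measurable[OF pieces(1,2) borel_SV] unfolding excess_def
  by measurable

text \<open>This is the averaged renewal theorem for \<open>p i = r i powr D\<close> and \<open>\<tau> i = - ln (r i)\<close>.\<close>

lemma average_of_scaled_V:
  obtains C where "0 \<le> C"
    "(\<integral>\<^sup>+s. ennreal (scaled F \<Gamma> (exp s) + (\<Sum>i\<in>I. excess i (exp s))) \<partial>lborel) = ennreal C"
    "(log_average V \<longlongrightarrow> C / \<eta> + scaled_V_limit) at_top"
proof -
  obtain M where M: "\<And>\<epsilon>. \<epsilon> > 0 \<Longrightarrow> scaled F V \<epsilon> \<le> M" using scaled_V_bounded by blast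
  show thesis
  proof (rule averaged_renewal_theorem[of I "\<lambda>i. r i powr D" "\<lambda>i. - ln (r i)" \<eta> "\<lambda>s. scaled F V (exp s)" M scaled_V_limit
        "\<lambda>s. scaled F \<Gamma> (exp s) + (\<Sum>i\<in>I. excess i (exp s))"])
    show "scaled F \<Gamma> (exp s) + (\<Sum>i\<in>I. excess i (exp s))
       = scaled F V (exp s) - (\<Sum>i\<in>I. r i powr D * scaled F V (exp (s + - ln (r i))))" for s
    proof -
      have "exp (s + - ln (r i)) = exp s / r i" if "i \<in> I" for i using r[OF that] by (simp add: exp_diff)
      then show ?thesis using renewal_equation[of "exp s"] by simp
    qed
    show "\<eta> = (\<Sum>i\<in>I. r i powr D * - ln (r i))" by (simp add: \<eta>_def sum_negf)
    show "0 \<le> scaled F \<Gamma> (exp s) + (\<Sum>i\<in>I. excess i (exp s))" for s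
      by (intro add_nonneg_nonneg sum_nonneg excess_nonneg) auto
    fix C assume "0 \<le> C"
      "(\<integral>\<^sup>+s. ennreal (scaled F \<Gamma> (exp s) + (\<Sum>i\<in>I. excess i (exp s))) \<partial>lborel) = ennreal C"
      "((\<lambda>T. 1 / T * integral {-T..0} (\<lambda>s. scaled F V (exp s))) \<longlongrightarrow> C / \<eta> + scaled_V_limit) at_top"
    then show thesis using that unfolding log_average_def by blast
  qed (use I D r M \<eta>_pos feasible scaled_exp_measurable(1)[OF feasible(4)] scaled_tendsto_at_top in auto)
qed

lemma content_integral_eq:
  assumes W: "W \<in> sets borel"
  shows "content_integral D F W = (\<integral>\<^sup>+s. ennreal (scaled F W (exp s)) \<partial>lborel)"
proof -
  note [measurable] = parallel_volume_measurable[OF attractor(3,1) W]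
  let ?h = "\<lambda>\<epsilon>. ennreal (\<epsilon> powr (D - real DIM('a) - 1) * parallel_volume F W \<epsilon>)"
  have "content_integral D F W = (\<integral>\<^sup>+\<epsilon>\<in>{0<..}. ?h \<epsilon> \<partial>lborel)"
    unfolding content_integral_def emeasure_parallel_set[OF attractor(3,1) W] by (simp add: ennreal_mult)
  also have "\<dots> = (\<integral>\<^sup>+s. ?h (exp s) * ennreal (exp s) \<partial>lborel)"
    by (rule nn_integral_exp_substitution) measurable
  also have "\<dots> = (\<integral>\<^sup>+s. ennreal (scaled F W (exp s)) \<partial>lborel)"
  proof (rule nn_integral_cong)
    fix s :: real
    have "exp s powr (D - real DIM('a) - 1) * parallel_volume F W (exp s) * exp s = scaled F W (exp s)"
      by (simp add: scaled_def powr_diff)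
    then show "?h (exp s) * ennreal (exp s) = ennreal (scaled F W (exp s))"
      by (simp add: ennreal_mult[symmetric])
  qed
  finally show ?thesis .
qed

text \<open>If the distances to \<open>F\<close> and to \<open>S i ` F\<close> differ at one point of the open set \<open>S i ` V\<close>, then they are
  separated on a ball around it, and this ball contributes to the excess for an interval of parallel distances.\<close>

lemma excess_zero_iff:
  assumes i: "i \<in> I"
  shows "(AE s in lborel. excess i (exp s) = 0) \<longleftrightarrow> S i ` V \<subseteq> closure (projection_preimage F (S i ` F))"
proof -
  have iff: "S i ` V \<subseteq> closure (projection_preimage F (S i ` F)) \<longleftrightarrow> (\<forall>x\<in>S i ` V. infdist x F = infdist x (S i ` F))"
    using closure_projection_preimage[OF attractor(4) pieces(4,2,3)[OF i]] by blast
  have "AE s in lborel. excess i (exp s) = 0" if eq: "\<forall>x\<in>S i ` V. infdist x F = infdist x (S i ` F)"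
  proof (rule AE_I2)
    fix s
    have "(parallel_set F (exp s) - parallel_set (S i ` F) (exp s)) \<inter> S i ` V = {}"
      using eq by (auto simp: parallel_set_def simp del: image_iff)
    then show "excess i (exp s) = 0" by (simp only: excess_eq[OF i]) simp
  qed
  moreover have "infdist x F = infdist x (S i ` F)"
    if ae: "AE s in lborel. excess i (exp s) = 0" and x: "x \<in> S i ` V" for x
  proof (rule ccontr)
    assume "infdist x F \<noteq> infdist x (S i ` F)"
    then have lt: "infdist x F < infdist x (S i ` F)" using infdist_mono[OF pieces(3,2)[OF i], of x] by simp
    define \<gamma> where "\<gamma> = (infdist x (S i ` F) - infdist x F) / 4"
    have \<gamma>: "\<gamma> > 0" using lt by (simp add: \<gamma>_def)
    obtain \<rho> where \<rho>: "\<rho> > 0" "ball x \<rho> \<subseteq> S i ` V" using open_SV[OF i] x openE by blast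
    define a where "a = infdist x F + \<gamma>"
    define b where "b = infdist x (S i ` F) - \<gamma>"
    have ab: "0 < a" "a < b" using \<gamma> infdist_nonneg[of x F] by (auto simp: a_def b_def \<gamma>_def field_simps)
    have pos: "excess i (exp s) \<noteq> 0" if s: "s \<in> {ln a<..<ln b}" for s
    proof -
      have "exp (ln a) < exp s" "exp s < exp (ln b)" using s by simp_all
      then have e: "a \<le> exp s" "exp s < b" using ab by simp_all
      let ?X = "(parallel_set F (exp s) - parallel_set (S i ` F) (exp s)) \<inter> S i ` V"
      have sub: "ball x (min \<rho> \<gamma>) \<subseteq> ?X"
      proof
        fix y assume y: "y \<in> ball x (min \<rho> \<gamma>)"
        have "infdist y F \<le> infdist x F + dist y x" by (rule infdist_triangle)
        moreover have "infdist x (S i ` F) \<le> infdist y (S i ` F) + dist x y" by (rule infdist_triangle)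
        ultimately show "y \<in> ?X" using y e \<rho> by (auto simp: parallel_set_def a_def b_def dist_commute)
      qed
      have "?X = (parallel_set F (exp s) \<inter> S i ` V) - parallel_set (S i ` F) (exp s)" by blast
      also have "\<dots> \<in> lmeasurable"
      proof (rule fmeasurable_Diff[OF lmeasurable_parallel_set_Int[OF attractor(3,1) borel_SV[OF i]]])
        show "parallel_set (S i ` F) (exp s) \<in> sets lebesgue"
          using borel_parallel_set[of "S i ` F" "exp s"] by simp
      qed
      finally have "measure lebesgue (ball x (min \<rho> \<gamma>)) \<le> measure lebesgue ?X"
        using sub by (intro measure_mono_fmeasurable) auto
      moreover have "0 < measure lebesgue (ball x (min \<rho> \<gamma>))" using content_ball_pos[of "min \<rho> \<gamma>" x] \<rho> \<gamma> by simp
      ultimately have "0 < measure lebesgue ?X" by linarith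
      then show ?thesis unfolding excess_eq[OF i] by simp
    qed
    have "{s. excess i (exp s) \<noteq> 0} \<in> sets lborel" using excess_measurable[OF i] by measurable
    then have "{s. excess i (exp s) \<noteq> 0} \<in> null_sets lborel"
      using ae by (subst AE_iff_null_sets) auto
    then have "{ln a<..<ln b} \<in> null_sets lborel"
      by (rule null_sets_subset) (use pos in auto)
    then have "emeasure lborel {ln a<..<ln b} = 0" by auto
    moreover have "ln a < ln b" using ab by simp
    ultimately show False by simp
  qed
  ultimately show ?thesis unfolding iff by blast
qed

lemma projection_condition_iff:
  "(\<integral>\<^sup>+s. ennreal (\<Sum>i\<in>I. excess i (exp s)) \<partial>lborel) = 0 \<longleftrightarrow> projection_condition N S F V"
proof -
  have m: "(\<lambda>s. ennreal (\<Sum>i\<in>I. excess i (exp s))) \<in> borel_measurable lborel"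
    using excess_measurable by measurable
  have "(\<integral>\<^sup>+s. ennreal (\<Sum>i\<in>I. excess i (exp s)) \<partial>lborel) = 0 \<longleftrightarrow> (AE s in lborel. ennreal (\<Sum>i\<in>I. excess i (exp s)) = 0)"
    by (rule nn_integral_0_iff_AE[OF m])
  also have "\<dots> \<longleftrightarrow> (AE s in lborel. \<forall>i\<in>I. excess i (exp s) = 0)"
  proof -
    have "ennreal (\<Sum>i\<in>I. excess i (exp s)) = 0 \<longleftrightarrow> (\<forall>i\<in>I. excess i (exp s) = 0)" for s
    proof -
      have "0 \<le> (\<Sum>i\<in>I. excess i (exp s))" by (intro sum_nonneg excess_nonneg)
      then have "ennreal (\<Sum>i\<in>I. excess i (exp s)) = 0 \<longleftrightarrow> (\<Sum>i\<in>I. excess i (exp s)) = 0"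
        by (simp only: ennreal_eq_0_iff) linarith
      also have "\<dots> \<longleftrightarrow> (\<forall>i\<in>I. excess i (exp s) = 0)"
        by (rule sum_nonneg_eq_0_iff[OF I(1) excess_nonneg])
      finally show ?thesis .
    qed
    then show ?thesis by simp
  qed
  also have "\<dots> \<longleftrightarrow> (\<forall>i\<in>I. AE s in lborel. excess i (exp s) = 0)"
    using I(1) by (rule AE_finite_all)
  also have "\<dots> \<longleftrightarrow> projection_condition N S F V"
    unfolding projection_condition_def using excess_zero_iff by blast
  finally show ?thesis .
qed

section \<open>Average content and the projection condition\<close>

lemma log_average_UNIV_tendsto:
  assumes "(log_average V \<longlongrightarrow> K) at_top"
  shows "(log_average UNIV \<longlongrightarrow> K) at_top"
  using tendsto_add[OF assms log_average_tendsto[OF borel_outside scaled_outside_tendsto_0]]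
  by (simp add: log_average_split[abs_def])

lemma has_average_minkowski_content_unique:
  assumes W: "W \<in> sets borel" and lim: "(log_average W \<longlongrightarrow> K) at_top"
  shows "has_average_minkowski_content D F W m \<longleftrightarrow> m = ennreal K"
  unfolding has_average_minkowski_content_iff[OF W]
  using tendsto_ennrealI[OF lim] tendsto_unique[OF trivial_limit_at_top_linorder] by blast

text \<open>The upper bound for the parallel volume excludes an infinite content.\<close>

lemma has_minkowski_content_finite:
  assumes W: "W \<in> sets borel" and m: "has_minkowski_content D F W m"
  obtains L where "0 \<le> L" "m = ennreal L" "(scaled F W \<longlongrightarrow> L) (at_right 0)"
proof -
  have lim: "((\<lambda>\<epsilon>. ennreal (scaled F W \<epsilon>)) \<longlongrightarrow> m) (at_right 0)"
    using m has_minkowski_content_iff[OF W] by blast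
  obtain B where B: "0 \<le> B" "\<And>\<epsilon>. 0 < \<epsilon> \<Longrightarrow> \<epsilon> \<le> 1 \<Longrightarrow> scaled F UNIV \<epsilon> \<le> B" using scaled_UNIV_bounded by blast
  have "ennreal (scaled F W \<epsilon>) \<le> ennreal B" if "0 < \<epsilon>" "\<epsilon> < 1" for \<epsilon>
    using scaled_mono[OF attractor(3,1) W, of UNIV \<epsilon>] B(2)[of \<epsilon>] that by (intro ennreal_leI) auto
  then have "\<forall>\<^sub>F \<epsilon> in at_right 0. ennreal (scaled F W \<epsilon>) \<le> ennreal B"
    unfolding eventually_at_right_field by (intro exI[of _ 1]) auto
  then have "m \<le> ennreal B" by (rule tendsto_upperbound[OF lim]) simp
  then obtain L where L: "0 \<le> L" "m = ennreal L" by (cases m) (auto simp: top_unique)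
  have "(scaled F W \<longlongrightarrow> L) (at_right 0)"
    using lim L by (subst (asm) L(2)) (rule tendsto_ennrealD, auto)
  then show ?thesis using that L by blast
qed

lemma has_minkowski_contentI:
  assumes "W \<in> sets borel" "(scaled F W \<longlongrightarrow> L) (at_right 0)"
  shows "has_minkowski_content D F W (ennreal L)"
  using assms by (simp add: has_minkowski_content_iff tendsto_ennrealI)

text \<open>The two contents differ by the content outside of \<open>V\<close>, which is zero.\<close>

lemma minkowski_content_UNIV_iff:
  "has_minkowski_content D F UNIV m \<longleftrightarrow> has_minkowski_content D F V m"
proof
  assume "has_minkowski_content D F UNIV m"
  then obtain L where L: "m = ennreal L" "(scaled F UNIV \<longlongrightarrow> L) (at_right 0)"
    by (rule has_minkowski_content_finite[rotated]) auto
  have "((\<lambda>\<epsilon>. scaled F UNIV \<epsilon> - scaled F (- V) \<epsilon>) \<longlongrightarrow> L - 0) (at_right 0)"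
    by (intro tendsto_diff L scaled_outside_tendsto_0)
  then have "(scaled F V \<longlongrightarrow> L) (at_right 0)" by (simp add: scaled_split)
  then show "has_minkowski_content D F V m" using has_minkowski_contentI[OF feasible(4)] L by blast
next
  assume "has_minkowski_content D F V m"
  then obtain L where L: "m = ennreal L" "(scaled F V \<longlongrightarrow> L) (at_right 0)"
    by (rule has_minkowski_content_finite[OF feasible(4)]) auto
  have "((\<lambda>\<epsilon>. scaled F V \<epsilon> + scaled F (- V) \<epsilon>) \<longlongrightarrow> L + 0) (at_right 0)"
    by (intro tendsto_add L scaled_outside_tendsto_0)
  then have "(scaled F UNIV \<longlongrightarrow> L) (at_right 0)" by (simp add: scaled_split[abs_def])
  then show "has_minkowski_content D F UNIV m" using has_minkowski_contentI L by auto
qed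

lemma minkowski_imp_average_content:
  assumes W: "W \<in> sets borel" and m: "has_minkowski_content D F W m"
  shows "has_average_minkowski_content D F W m"
proof -
  obtain L where "m = ennreal L" "(scaled F W \<longlongrightarrow> L) (at_right 0)"
    by (rule has_minkowski_content_finite[OF W m])
  then show ?thesis using has_average_minkowski_content_unique[OF W log_average_tendsto[OF W]] by blast
qed

lemma minkowski_iff_average_content:
  assumes "\<exists>m. has_minkowski_content D F UNIV m"
  shows "has_minkowski_content D F UNIV m \<longleftrightarrow> has_average_minkowski_content D F UNIV m"
proof -
  obtain m0 where m0: "has_minkowski_content D F UNIV m0" using assms by blast
  then obtain L where L: "m0 = ennreal L" "(scaled F UNIV \<longlongrightarrow> L) (at_right 0)"
    by (rule has_minkowski_content_finite[rotated]) auto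
  have "has_average_minkowski_content D F UNIV m \<longleftrightarrow> m = m0" for m
    using has_average_minkowski_content_unique[OF _ log_average_tendsto[OF _ L(2)]] L(1) by simp
  then show ?thesis using m0 minkowski_imp_average_content[of UNIV m] by auto
qed

text \<open>The average content exceeds the right-hand side by \<open>e / \<eta> + scaled_V_limit\<close>, where \<open>e\<close> is the integral
  of the excess terms. Both summands are nonnegative.\<close>

lemma average_content_formula:
  "has_average_minkowski_content D F UNIV (ennreal (1 / \<eta>) * content_integral D F \<Gamma>)
     \<longleftrightarrow> D < real DIM('a) \<and> projection_condition N S F V"
proof -
  let ?E = "\<integral>\<^sup>+s. ennreal (\<Sum>i\<in>I. excess i (exp s)) \<partial>lborel"
  obtain C where C: "0 \<le> C"
    "(\<integral>\<^sup>+s. ennreal (scaled F \<Gamma> (exp s) + (\<Sum>i\<in>I. excess i (exp s))) \<partial>lborel) = ennreal C"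
    "(log_average V \<longlongrightarrow> C / \<eta> + scaled_V_limit) at_top"
    by (rule average_of_scaled_V)
  have ex0: "0 \<le> (\<Sum>i\<in>I. excess i \<epsilon>)" for \<epsilon> by (intro sum_nonneg excess_nonneg)
  have meas: "(\<lambda>s. \<Sum>i\<in>I. excess i (exp s)) \<in> borel_measurable borel"
    by (rule borel_measurable_sum[OF excess_measurable])
  have "(\<integral>\<^sup>+s. ennreal (scaled F \<Gamma> (exp s)) \<partial>lborel) + ?E
      = (\<integral>\<^sup>+s. ennreal (scaled F \<Gamma> (exp s)) + ennreal (\<Sum>i\<in>I. excess i (exp s)) \<partial>lborel)"
    using scaled_exp_measurable(1)[OF borel_\<Gamma>] meas
    by (intro nn_integral_add[symmetric]) (auto intro!: measurable_compose[OF _ measurable_ennreal])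
  also have "\<dots> = ennreal C" using C(2) ex0 by (simp add: ennreal_plus)
  finally have sum: "content_integral D F \<Gamma> + ?E = ennreal C"
    using content_integral_eq[OF borel_\<Gamma>] by simp
  obtain c where c: "0 \<le> c" "content_integral D F \<Gamma> = ennreal c"
    using sum by (cases "content_integral D F \<Gamma>") auto
  obtain e where e: "0 \<le> e" "?E = ennreal e"
    using sum by (cases ?E) auto
  have ce: "c + e = C" using sum c e C(1) by (simp add: ennreal_plus[symmetric] del: ennreal_plus)
  have L0: "0 \<le> scaled_V_limit" by (simp add: scaled_V_limit_def)
  have "has_average_minkowski_content D F UNIV (ennreal (1 / \<eta>) * content_integral D F \<Gamma>)
     \<longleftrightarrow> ennreal (1 / \<eta>) * content_integral D F \<Gamma> = ennreal (C / \<eta> + scaled_V_limit)"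
    by (rule has_average_minkowski_content_unique[OF _ log_average_UNIV_tendsto[OF C(3)]]) simp
  also have "\<dots> \<longleftrightarrow> c / \<eta> = (c + e) / \<eta> + scaled_V_limit"
    unfolding c(2) ce using c(1) C(1) L0 \<eta>_pos by (simp add: ennreal_mult[symmetric] del: ennreal_plus)
  also have "\<dots> \<longleftrightarrow> e / \<eta> + scaled_V_limit = 0" by (simp add: add_divide_distrib)
  also have "\<dots> \<longleftrightarrow> e = 0 \<and> scaled_V_limit = 0"
    using e(1) L0 \<eta>_pos by (simp add: add_nonneg_eq_0_iff)
  also have "e = 0 \<longleftrightarrow> projection_condition N S F V"
    using projection_condition_iff e by simp
  also have "scaled_V_limit = 0 \<longleftrightarrow> D < real DIM('a)"
    using V_measure(3) by (simp add: scaled_V_limit_def)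
  finally show ?thesis by blast
qed

lemma closure_ifs_image: "closure (ifs_image N S V) \<subseteq> (\<Union>i\<in>I. S i ` closure V)"
proof (rule closure_minimal)
  show "ifs_image N S V \<subseteq> (\<Union>i\<in>I. S i ` closure V)"
    unfolding ifs_image_def using closure_subset by blast
  have "compact (closure V)" using feasible(2) by simp
  then show "closed (\<Union>i\<in>I. S i ` closure V)"
    using S_compact by (intro closed_UN) (auto intro: compact_imp_closed)
qed

lemma frontier_V: "frontier V = closure V - V"
  using feasible(3) by (simp add: frontier_def interior_open)

text \<open>The closure of \<open>V\<close> is covered by the closures of \<open>G\<close> and of the sets \<open>S i ` V\<close>.\<close>

lemma frontier_V_subset:
  assumes G: "G = V - closure (ifs_image N S V)"
  shows "frontier V \<subseteq> frontier G \<union> (\<Union>i\<in>I. S i ` frontier V)"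
proof
  fix x assume "x \<in> frontier V"
  then have x: "x \<in> closure V" "x \<notin> V" by (auto simp: frontier_V)
  have "open G" unfolding G using feasible(3) by (intro open_Diff) auto
  have "V \<subseteq> G \<union> closure (ifs_image N S V)" using G by blast
  then have "closure V \<subseteq> closure (G \<union> closure (ifs_image N S V))" by (rule closure_mono)
  then have "x \<in> closure G \<or> x \<in> closure (ifs_image N S V)" using x(1) by auto
  then show "x \<in> frontier G \<union> (\<Union>i\<in>I. S i ` frontier V)"
  proof
    assume "x \<in> closure G"
    moreover have "x \<notin> G" using x G by blast
    ultimately show ?thesis using \<open>open G\<close> by (simp add: frontier_def interior_open)
  next
    assume "x \<in> closure (ifs_image N S V)"
    then obtain i y where y: "i \<in> I" "y \<in> closure V" "x = S i y" using closure_ifs_image by blast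
    then have "y \<notin> V" using x feasible(5) by blast
    then show ?thesis using y by (auto simp: frontier_V)
  qed
qed

text \<open>The volume \<open>v\<close> of the frontier of \<open>V\<close> satisfies \<open>v \<le> (\<Sum>i\<in>I. r i ^ DIM('a)) * v\<close> with a factor smaller than one.\<close>

lemma frontier_V_null:
  assumes "D < real DIM('a)" and G: "G = V - closure (ifs_image N S V)"
    and null: "emeasure lebesgue (frontier G) = 0"
  shows "measure lebesgue (frontier V) = 0"
proof -
  have bd: "bounded G" using feasible(2) by (rule bounded_subset) (auto simp: G)
  have m: "frontier V \<in> lmeasurable" "frontier G \<in> lmeasurable"
    using feasible(2) bd by (auto intro!: lmeasurable_compact)
  have mS: "S i ` frontier V \<in> lmeasurable" if "i \<in> I" for i
    using feasible(2) that by (intro lmeasurable_compact S_compact) auto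
  have U: "(\<Union>i\<in>I. S i ` frontier V) \<in> lmeasurable" using mS I by (intro fmeasurable.finite_UN) auto
  have "measure lebesgue (frontier V) \<le> measure lebesgue (frontier G \<union> (\<Union>i\<in>I. S i ` frontier V))"
    using m U by (intro measure_mono_fmeasurable frontier_V_subset[OF G]) (auto intro: fmeasurableD)
  also have "\<dots> \<le> measure lebesgue (frontier G) + measure lebesgue (\<Union>i\<in>I. S i ` frontier V)"
    using m U by (intro measure_Un_le) (auto intro: fmeasurableD)
  also have "measure lebesgue (frontier G) = 0" using null by (simp add: measure_def)
  also have "measure lebesgue (\<Union>i\<in>I. S i ` frontier V) \<le> (\<Sum>i\<in>I. measure lebesgue (S i ` frontier V))"
    using I mS by (intro measure_UNION_le) (auto intro: fmeasurableD)
  also have "\<dots> = (\<Sum>i\<in>I. r i ^ DIM('a) * measure lebesgue (frontier V))"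
    by (intro sum.cong refl similarity_measure r dist_S) auto
  also have "\<dots> = (\<Sum>i\<in>I. r i ^ DIM('a)) * measure lebesgue (frontier V)" by (simp add: sum_distrib_right)
  finally have "(1 - (\<Sum>i\<in>I. r i ^ DIM('a))) * measure lebesgue (frontier V) \<le> 0" by (simp add: algebra_simps)
  then have "measure lebesgue (frontier V) \<le> 0"
    using sum_ratio_power_lt_1[OF assms(1)] by (simp add: mult_le_0_iff)
  then show ?thesis using measure_nonneg[of lebesgue "frontier V"] by linarith
qed

text \<open>Points of \<open>\<Gamma>\<close> that are not in \<open>G\<close> lie in the image of the frontier of \<open>V\<close> under some \<open>S i\<close>. Although
  the frontier of \<open>V\<close> need not lie in that of \<open>G\<close>, it is null together with it if \<open>D\<close> is less than the
  dimension; in the other case \<open>\<Gamma>\<close> is null.\<close>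

lemma content_integral_interior:
  assumes G: "G = V - closure (ifs_image N S V)" and null: "emeasure lebesgue (frontier G) = 0"
  shows "content_integral D F G = content_integral D F \<Gamma>"
proof -
  have GG: "G \<subseteq> \<Gamma>" using closure_subset unfolding G \<Gamma>_def by blast
  have borel_G: "G \<in> sets borel" unfolding G using feasible(3) by (intro borel_open open_Diff) auto
  have diff: "\<Gamma> - G \<in> sets borel" using borel_\<Gamma> borel_G by blast
  have bd: "bounded (\<Gamma> - G)" using feasible(2) by (rule bounded_subset) (auto simp: \<Gamma>_def)
  have dm: "\<Gamma> - G \<in> lmeasurable" using bd diff by (intro bounded_set_imp_lmeasurable) auto
  have "measure lebesgue (\<Gamma> - G) = 0"
  proof (cases "D < real DIM('a)")
    case True
    have sub: "\<Gamma> - G \<subseteq> (\<Union>i\<in>I. S i ` frontier V)"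
    proof
      fix x assume "x \<in> \<Gamma> - G"
      then have x: "x \<in> closure (ifs_image N S V)" "x \<notin> ifs_image N S V" by (auto simp: G \<Gamma>_def)
      then obtain i y where y: "i \<in> I" "y \<in> closure V" "x = S i y" using closure_ifs_image by blast
      then have "y \<notin> V" using x(2) unfolding ifs_image_def by blast
      then show "x \<in> (\<Union>i\<in>I. S i ` frontier V)" using y by (auto simp: frontier_V)
    qed
    have mS: "S i ` frontier V \<in> lmeasurable" if "i \<in> I" for i
      using feasible(2) that by (intro lmeasurable_compact S_compact) auto
    have "measure lebesgue (\<Gamma> - G) \<le> measure lebesgue (\<Union>i\<in>I. S i ` frontier V)"
      using dm mS I by (intro measure_mono_fmeasurable sub fmeasurable.finite_UN) (auto intro: fmeasurableD)
    also have "\<dots> \<le> (\<Sum>i\<in>I. measure lebesgue (S i ` frontier V))"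
      using I mS by (intro measure_UNION_le) (auto intro: fmeasurableD)
    also have "\<dots> = (\<Sum>i\<in>I. r i ^ DIM('a) * measure lebesgue (frontier V))"
      by (intro sum.cong refl similarity_measure r dist_S) auto
    also have "\<dots> = 0" using frontier_V_null[OF True G null] by simp
    finally show ?thesis using measure_nonneg[of lebesgue "\<Gamma> - G"] by linarith
  next
    case False
    then have "measure lebesgue \<Gamma> = 0" using D_le_d by (intro measure_\<Gamma>_0) simp
    moreover have "measure lebesgue (\<Gamma> - G) \<le> measure lebesgue \<Gamma>"
      using V_measure(2) dm by (intro measure_mono_fmeasurable) (auto intro: fmeasurableD)
    ultimately show ?thesis using measure_nonneg[of lebesgue "\<Gamma> - G"] by linarith
  qed
  then have zero: "parallel_volume F (\<Gamma> - G) \<epsilon> = 0" for \<epsilon>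
  proof -
    assume z: "measure lebesgue (\<Gamma> - G) = 0"
    have "parallel_volume F (\<Gamma> - G) \<epsilon> \<le> measure lebesgue (\<Gamma> - G)" unfolding parallel_volume_def
      using dm fmeasurableD[OF lmeasurable_parallel_set_Int[OF attractor(3,1) diff]]
      by (intro measure_mono_fmeasurable) auto
    then show ?thesis using z parallel_volume_nonneg[of F "\<Gamma> - G" \<epsilon>] by linarith
  qed
  have "parallel_volume F \<Gamma> \<epsilon> = parallel_volume F G \<epsilon>" for \<epsilon>
  proof -
    have "\<Gamma> = G \<union> (\<Gamma> - G)" using GG by blast
    then show ?thesis
      using parallel_volume_Un[OF attractor(3,1) borel_G diff, of \<epsilon>] zero[of \<epsilon>] by auto
  qed
  then show ?thesis
    unfolding content_integral_eq[OF borel_G] content_integral_eq[OF borel_\<Gamma>] scaled_def by simp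
qed

end

theorem theorem3p17:
  fixes N :: nat
    and S :: "nat \<Rightarrow> 'a::euclidean_space \<Rightarrow> 'a"
    and r :: "nat \<Rightarrow> real"
    and F V \<Gamma> G :: "'a set"
    and D \<eta> :: real
  assumes ifs: "similarity_ifs N S r"
    and F: "self_similar_set N S F"
    and osc: "open_set_condition N S"
    and D: "(\<Sum>i=1..N. r i powr D) = 1"
    and V: "strong_feasible_open_set N S F V"
    and \<eta>: "\<eta> = - (\<Sum>i=1..N. r i powr D * ln (r i))"
    and \<Gamma>: "\<Gamma> = V - ifs_image N S V"
    and G: "G = V - closure (ifs_image N S V)"
  shows
    "(has_minkowski_content D F (- V) 0
      \<and> (\<exists>m. has_average_minkowski_content D F UNIV m \<and> has_average_minkowski_content D F V m)
      \<and> (minkowski_measurable D F \<longleftrightarrow> (\<exists>m. has_minkowski_content D F V m \<and> 0 < m \<and> m < \<infinity>))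
      \<and> (minkowski_measurable D F \<longrightarrow>
           (\<exists>m. has_minkowski_content D F UNIV m \<and> has_minkowski_content D F V m)))
    \<and> ((has_average_minkowski_content D F UNIV (ennreal (1 / \<eta>) * content_integral D F \<Gamma>)
          \<longleftrightarrow> D < real DIM('a) \<and> projection_condition N S F V)
      \<and> ((\<exists>m. has_minkowski_content D F UNIV m) \<longrightarrow>
          (has_minkowski_content D F UNIV (ennreal (1 / \<eta>) * content_integral D F \<Gamma>)
            \<longleftrightarrow> D < real DIM('a) \<and> projection_condition N S F V)))
    \<and> (emeasure lebesgue (frontier G) = 0 \<longrightarrow>
        (has_average_minkowski_content D F UNIV (ennreal (1 / \<eta>) * content_integral D F G)
          \<longleftrightarrow> D < real DIM('a) \<and> projection_condition N S F V)
      \<and> ((\<exists>m. has_minkowski_content D F UNIV m) \<longrightarrow>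
          (has_minkowski_content D F UNIV (ennreal (1 / \<eta>) * content_integral D F G)
            \<longleftrightarrow> D < real DIM('a) \<and> projection_condition N S F V)))"
proof -
  interpret sys: self_similar_system N S r F V D
    by unfold_locales (rule ifs F D V)+
  have \<eta>': "\<eta> = sys.\<eta>" unfolding \<eta> sys.\<eta>_def ..
  have \<Gamma>': "\<Gamma> = sys.\<Gamma>" unfolding \<Gamma> sys.\<Gamma>_def ..
  have outside: "has_minkowski_content D F (- V) 0"
    using sys.has_minkowski_contentI[OF sys.borel_outside sys.scaled_outside_tendsto_0] by simp
  obtain K where K: "(sys.log_average V \<longlongrightarrow> K) at_top" using sys.average_of_scaled_V by blast
  have avg: "has_average_minkowski_content D F UNIV (ennreal K) \<and> has_average_minkowski_content D F V (ennreal K)"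
    using sys.has_average_minkowski_content_unique[OF _ sys.log_average_UNIV_tendsto[OF K]]
      sys.has_average_minkowski_content_unique[OF sys.feasible(4) K] by simp
  have measurable: "minkowski_measurable D F \<longleftrightarrow> (\<exists>m. has_minkowski_content D F V m \<and> 0 < m \<and> m < \<infinity>)"
    unfolding minkowski_measurable_def sys.minkowski_content_UNIV_iff ..
  have both: "minkowski_measurable D F \<longrightarrow> (\<exists>m. has_minkowski_content D F UNIV m \<and> has_minkowski_content D F V m)"
    unfolding minkowski_measurable_def sys.minkowski_content_UNIV_iff by blast
  have formula: "has_average_minkowski_content D F UNIV (ennreal (1 / \<eta>) * content_integral D F \<Gamma>)
          \<longleftrightarrow> D < real DIM('a) \<and> projection_condition N S F V"
    unfolding \<eta>' \<Gamma>' by (rule sys.average_content_formula)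
  have formula': "(\<exists>m. has_minkowski_content D F UNIV m) \<longrightarrow>
          (has_minkowski_content D F UNIV (ennreal (1 / \<eta>) * content_integral D F \<Gamma>)
            \<longleftrightarrow> D < real DIM('a) \<and> projection_condition N S F V)"
    using formula sys.minkowski_iff_average_content by blast
  have interior: "content_integral D F G = content_integral D F \<Gamma>" if "emeasure lebesgue (frontier G) = 0"
    unfolding \<Gamma>' by (rule sys.content_integral_interior[OF G that])
  show ?thesis
    using outside avg measurable both formula formula' interior by auto
qed

end
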